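(* Let $n$ be a positive integer and let $P=(p_{ij})_{1\le i,j\le n}$ be the random matrix $P=I_n-R$ associated with a uniform random vector $X$ on the unit sphere of $\mathbb{C}^n$ (explicit entries in the context). Let $m,l$ be nonnegative integers, and consider four sequences $$\boldsymbol{i}=(i_1,\dots,i_m),\quad \boldsymbol{j}=(j_1,\dots,j_m),\quad \boldsymbol{i}'=(i_1',\dots,i_l'),\quad \boldsymbol{j}'=(j_1',\dots,j_l')$$ of integers in $\{1,\dots,n\}$. Then the moment $$\mathbb{E}\bigl[p_{i_1j_1}\cdots p_{i_mj_m}\,\overline{p_{i_1'j_1'}\cdots p_{i_l'j_l'}}\bigr]$$ vanishes unless $\boldsymbol{i}\sqcup\boldsymbol{j}'$ is a permutation (rearrangement) of $\boldsymbol{j}\sqcup\boldsymbol{i}'$. If $\boldsymbol{i}\sqcup\boldsymbol{j}'$ is a permutation of $\boldsymbol{j}\sqcup\boldsymbol{i}'$, the moment is equal to $$\alpha_1!\cdots\alpha_{n-1}!\;\frac{n^{\uparrow\alpha_n}}{n^{\uparrow m}\,n^{\uparrow l}},$$ where $\alpha_k:=\mathsf{m}_k(\boldsymbol{i}\sqcup\boldsymbol{j}')=\mathsf{m}_k(\boldsymbol{j}\sqcup\boldsymbol{i}')$ for $k=1,\dots,n$.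
   Context: Rising factorial: $a^{\uparrow k}=\prod_{j=0}^{k-1}(a+j)$ for $k\ge1$, and $a^{\uparrow 0}=1$. Sequences: for a finite sequence $\boldsymbol{i}=(i_1,\dots,i_m)$ of positive integers, $\mathsf{m}_k(\boldsymbol{i})=|\{h\in\{1,\dots,m\}: i_h=k\}|$ is the multiplicity of $k$ in $\boldsymbol{i}$. For $\boldsymbol{i}=(i_1,\dots,i_m)$ and $\boldsymbol{j}=(j_1,\dots,j_l)$, $\boldsymbol{i}\sqcup\boldsymbol{j}=(i_1,\dots,i_m,j_1,\dots,j_l)$ denotes concatenation. Random matrices: let $X=(x_1,\dots,x_n)^{\mathtt T}$ be uniformly distributed on the unit sphere of $\mathbb{C}^n$. Let $R=(r_{ij})_{1\le i,j\le n}$ be the matrix (in the standard basis $\boldsymbol{e}_1,\dots,\boldsymbol{e}_n$) of the almost surely unique complex reflection (unitary map differing from the identity by a rank-one map) sending $\boldsymbol{e}_n$ to $X$, and let $P=(p_{ij})_{1\le i,j\le n}:=I_n-R$. Explicitly (almost surely, where $x_n\neq1$), $$p_{ij}=\begin{cases}\dfrac{x_i\overline{x_j}}{1-\overline{x_n}} & i<n,\ j<n,\\[2mm] -\dfrac{1-x_n}{1-\overline{x_n}}\,\overline{x_j} & i=n,\ j<n,\\[2mm] -x_i & i<n,\ j=n,\\ 1-x_n & i=j=n.\end{cases}$$ *)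

theory Defs
  imports "HOL-Analysis.Analysis" "HOL-Probability.Probability"
begin

text \<open>
  Index convention: \<open>\<complex>\<^sup>n\<close> is \<open>complex ^ 'n\<close> with \<open>n = CARD('n)\<close>. The basis vector
  \<open>e\<^sub>n\<close> is \<open>axis N 1\<close> for a distinguished index \<open>N :: 'n\<close>, so that the
  indices \<open>1, \<dots>, n - 1\<close> are the elements of \<open>UNIV - {N}\<close>.
\<close>

section \<open>The uniform distribution on the unit sphere\<close>

text \<open>
  Normalized surface measure in polar coordinates: the probability of \<open>A\<close> is the normalized
  volume of the part of the unit ball lying on the rays through \<open>A\<close>. (The value at the
  origin, a null set, is irrelevant.)
\<close>

definition uniform_sphere :: "'a::euclidean_space measure" where
  "uniform_sphere = distr (uniform_measure lborel (ball 0 1)) borel (\<lambda>x. x /\<^sub>R norm x)"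

lemma sets_uniform_sphere [measurable_cong, simp]: "sets uniform_sphere = sets borel"
  by (simp add: uniform_sphere_def)

lemma emeasure_unit_ball_pos_finite:
  "emeasure lborel (ball (0::'a::euclidean_space) 1) \<noteq> 0"
  "emeasure lborel (ball (0::'a::euclidean_space) 1) \<noteq> \<infinity>"
proof -
  have "measure lborel (ball (0::'a) 1) > 0"
    by (simp add: content_ball_pos)
  then show "emeasure lborel (ball (0::'a) 1) \<noteq> 0"
    by (auto simp: measure_def)
  show "emeasure lborel (ball (0::'a) 1) \<noteq> \<infinity>"
    using emeasure_lborel_ball_finite[of "0::'a" 1] by auto
qed

lemma prob_space_uniform_sphere: "prob_space (uniform_sphere :: 'a::euclidean_space measure)"
proof -
  interpret prob_space "uniform_measure lborel (ball (0::'a) 1)"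
    by (rule prob_space_uniform_measure) (use emeasure_unit_ball_pos_finite in auto)
  show ?thesis
    unfolding uniform_sphere_def by (rule prob_space_distr) simp
qed

lemma AE_uniform_sphereI:
  fixes Q :: "'a::euclidean_space \<Rightarrow> bool"
  assumes "{x. Q x} \<in> sets borel" "AE x in lborel. Q (x /\<^sub>R norm x)"
  shows "AE x in uniform_sphere. Q x"
  unfolding uniform_sphere_def
proof (subst AE_distr_iff)
  show "AE x in uniform_measure lborel (ball 0 1). Q (x /\<^sub>R norm x)"
    using assms(2) by (intro AE_uniform_measureI) auto
qed (use assms(1) in \<open>auto\<close>)

lemma AE_uniform_sphere_norm: "AE x in uniform_sphere. norm (x::'a::euclidean_space) = 1"
proof (rule AE_uniform_sphereI)
  have "AE x in lborel. x \<noteq> (0::'a)"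
    by (rule AE_lborel_singleton)
  then show "AE x in lborel. norm ((x::'a) /\<^sub>R norm x) = 1"
    by eventually_elim simp
qed simp

lemma AE_uniform_sphere_nth_neq_1:
  "AE x in uniform_sphere. (x :: complex ^ 'n) $ N \<noteq> 1"
proof (rule AE_uniform_sphereI)
  have ax: "axis N \<i> \<noteq> (0 :: complex ^ 'n)"
    by (metis axis_eq_0_iff complex_i_not_zero)
  have ip: "axis N \<i> \<bullet> x = Im (x $ N)" for x :: "complex ^ 'n"
    by (simp add: inner_axis' inner_complex_def)
  have "negligible {x :: complex ^ 'n. axis N \<i> \<bullet> x = 0}"
    using ax by (intro negligible_hyperplane) auto
  then have "{x :: complex ^ 'n. Im (x $ N) = 0} \<in> null_sets lebesgue"
    by (simp add: ip negligible_iff_null_sets)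
  moreover have "{x :: complex ^ 'n. Im (x $ N) = 0} \<in> sets borel"
    by (intro borel_closed closed_Collect_eq continuous_intros)
  ultimately have "AE x in lborel. Im ((x :: complex ^ 'n) $ N) \<noteq> 0"
    by (intro AE_I'[of "{x. Im (x $ N) = 0}"]) (auto simp: null_sets_def)
  then show "AE x in lborel. ((x :: complex ^ 'n) /\<^sub>R norm x) $ N \<noteq> 1"
  proof eventually_elim
    case (elim x)
    then have "x \<noteq> 0" by auto
    then have "Im ((x /\<^sub>R norm x) $ N) \<noteq> 0" using elim by simp
    then show ?case by (metis one_complex.sel(2))
  qed
next
  show "{x :: complex ^ 'n. x $ N \<noteq> 1} \<in> sets borel"
    by (intro borel_open open_Collect_neq continuous_intros)
qed

text \<open>Rotation invariance, which characterizes the uniform distribution on the sphere.\<close>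

lemma lborel_distr_orthogonal:
  fixes f :: "'a::euclidean_space \<Rightarrow> 'a"
  assumes f: "orthogonal_transformation f"
  shows "distr lborel borel f = lborel"
proof (rule measure_eqI)
  have lin: "linear f" and nrm: "\<And>x. norm (f x) = norm x"
    using f by (auto simp: orthogonal_transformation)
  have [measurable]: "f \<in> borel_measurable borel"
    using lin by (intro borel_measurable_continuous_onI linear_continuous_on linear_conv_bounded_linear[THEN iffD1])
  let ?n = "distr lborel borel f" and ?B = "ball (0::'a) 1"
  have tr: "(\<integral>\<^sup>+x. h (x + y) \<partial>lborel) = (\<integral>\<^sup>+x. h x \<partial>lborel)"
    if [measurable]: "h \<in> borel_measurable borel" for h :: "'a \<Rightarrow> ennreal" and y
  proof -
    have "(\<integral>\<^sup>+x. h x \<partial>distr lborel borel ((+) y)) = (\<integral>\<^sup>+x. h (y + x) \<partial>lborel)"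
      by (rule nn_integral_distr) auto
    then show ?thesis by (simp add: lborel_distr_plus add.commute)
  qed
  have neg: "(\<integral>\<^sup>+x. h (- x) \<partial>lborel) = (\<integral>\<^sup>+x. h x \<partial>lborel)"
    if [measurable]: "h \<in> borel_measurable borel" for h :: "'a \<Rightarrow> ennreal"
    by (subst (2) lborel_affine[of "-1" 0]) (simp_all add: nn_integral_density nn_integral_distr)
  have im: "emeasure ?n A = (\<integral>\<^sup>+x. indicator A (f x) \<partial>lborel)" if [measurable]: "A \<in> sets borel" for A
    using nn_integral_distr[of f lborel borel "indicator A :: 'a \<Rightarrow> ennreal"] by simp
  have key: "emeasure ?n A * emeasure lborel B = emeasure ?n B * emeasure lborel A"
    if [measurable]: "A \<in> sets borel" "B \<in> sets borel" and sym: "uminus ` B = B" for A B :: "'a set"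
  proof -
    have memB: "- b \<in> B \<longleftrightarrow> b \<in> B" for b using sym by (metis image_eqI minus_minus)
    have "emeasure ?n A * emeasure lborel B =
      (\<integral>\<^sup>+x. (\<integral>\<^sup>+y. indicator A (f x) * indicator B y \<partial>lborel) \<partial>lborel)"
      by (simp add: im nn_integral_cmult nn_integral_multc)
    also have "\<dots> = (\<integral>\<^sup>+x. (\<integral>\<^sup>+y. indicator A (f x) * indicator B (f x - y) \<partial>lborel) \<partial>lborel)"
    proof (rule nn_integral_cong)
      fix x
      have "(\<integral>\<^sup>+y. indicator A (f x) * indicator B (f x - y) \<partial>lborel) =
        (\<integral>\<^sup>+y. (\<lambda>y. indicator A (f x) * indicator B (- y)) (y + (- f x)) \<partial>lborel)"
        by simp
      also have "\<dots> = (\<integral>\<^sup>+y. indicator A (f x) * indicator B (- y) \<partial>lborel)"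
        by (rule tr) simp
      finally show "(\<integral>\<^sup>+y. indicator A (f x) * indicator B y \<partial>lborel) =
          (\<integral>\<^sup>+y. indicator A (f x) * indicator B (f x - y) \<partial>lborel)"
        by (simp add: indicator_def memB)
    qed
    also have "\<dots> = (\<integral>\<^sup>+y. (\<integral>\<^sup>+x. indicator A (f x) * indicator B (f x - y) \<partial>lborel) \<partial>lborel)"
      by (rule lborel_pair.Fubini') simp
    also have "\<dots> = (\<integral>\<^sup>+y. (\<integral>\<^sup>+x. indicator A (f x + y) * indicator B (f x) \<partial>lborel) \<partial>lborel)"
    proof (rule nn_integral_cong)
      fix y
      obtain z where z: "y = f z"
        using orthogonal_transformation_surj[OF f] by (metis surjD)
      have "(\<integral>\<^sup>+x. (\<lambda>x. indicator A (f x) * indicator B (f x - y)) (x + z) \<partial>lborel) =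
        (\<integral>\<^sup>+x. indicator A (f x) * indicator B (f x - y) \<partial>lborel)"
        by (rule tr) simp
      then show "(\<integral>\<^sup>+x. indicator A (f x) * indicator B (f x - y) \<partial>lborel) =
          (\<integral>\<^sup>+x. indicator A (f x + y) * indicator B (f x) \<partial>lborel)"
        by (simp add: z linear_add[OF lin])
    qed
    also have "\<dots> = (\<integral>\<^sup>+x. (\<integral>\<^sup>+y. indicator A (f x + y) * indicator B (f x) \<partial>lborel) \<partial>lborel)"
      by (rule lborel_pair.Fubini'[symmetric]) simp
    also have "\<dots> = (\<integral>\<^sup>+x. (\<integral>\<^sup>+y. indicator A y * indicator B (f x) \<partial>lborel) \<partial>lborel)"
    proof (rule nn_integral_cong)
      fix x
      have "(\<integral>\<^sup>+y. (\<lambda>y. indicator A y * indicator B (f x)) (y + f x) \<partial>lborel) =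
        (\<integral>\<^sup>+y. indicator A y * indicator B (f x) \<partial>lborel)"
        by (rule tr) simp
      then show "(\<integral>\<^sup>+y. indicator A (f x + y) * indicator B (f x) \<partial>lborel) =
          (\<integral>\<^sup>+y. indicator A y * indicator B (f x) \<partial>lborel)"
        by (simp add: add.commute)
    qed
    also have "\<dots> = emeasure ?n B * emeasure lborel A"
      by (simp add: im nn_integral_cmult nn_integral_multc mult.commute)
    finally show ?thesis .
  qed
  show "sets ?n = sets lborel" by simp
  fix A assume "A \<in> sets ?n"
  then have A: "A \<in> sets borel" by simp
  have "f -` ?B = ?B" by (auto simp: nrm)
  then have nB: "emeasure ?n ?B = emeasure lborel ?B"
    by (simp add: emeasure_distr)
  have "uminus ` ?B = ?B"
  proof (rule set_eqI)
    show "x \<in> uminus ` ?B \<longleftrightarrow> x \<in> ?B" for x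
      by (metis (no_types, lifting) dist_0_norm imageE image_eqI mem_ball minus_minus norm_minus_cancel)
  qed
  from key[OF A _ this] have "emeasure lborel ?B * emeasure ?n A = emeasure lborel ?B * emeasure lborel A"
    by (simp add: nB mult.commute)
  then show "emeasure ?n A = emeasure lborel A"
    using emeasure_unit_ball_pos_finite[where 'a='a] by (simp add: ennreal_mult_cancel_left)
qed

lemma uniform_sphere_orthogonal_invariant:
  fixes f :: "'a::euclidean_space \<Rightarrow> 'a"
  assumes f: "orthogonal_transformation f"
  shows "distr uniform_sphere borel f = uniform_sphere"
proof -
  have lin: "linear f" and nrm: "\<And>x. norm (f x) = norm x"
    using f by (auto simp: orthogonal_transformation)
  have [measurable]: "f \<in> borel_measurable borel"
    using lin by (intro borel_measurable_continuous_onI linear_continuous_on linear_conv_bounded_linear[THEN iffD1])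
  let ?U = "uniform_measure lborel (ball (0::'a) 1)"
  have U: "distr ?U borel f = ?U"
  proof (rule measure_eqI)
    fix A assume "A \<in> sets (distr ?U borel f)"
    then have [measurable]: "A \<in> sets borel" by simp
    have [measurable]: "f -` A \<in> sets borel"
      using measurable_sets[of f borel borel A] by simp
    have "emeasure lborel (ball 0 1 \<inter> A) = emeasure (distr lborel borel f) (ball 0 1 \<inter> A)"
      by (simp add: lborel_distr_orthogonal[OF f])
    also have "\<dots> = emeasure lborel (f -` (ball 0 1 \<inter> A))"
      by (simp add: emeasure_distr)
    also have "f -` (ball 0 1 \<inter> A) = ball 0 1 \<inter> f -` A"
      by (auto simp: nrm)
    finally show "emeasure (distr ?U borel f) A = emeasure ?U A"
      by (simp add: emeasure_distr)
  qed simp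
  have "distr uniform_sphere borel f = distr ?U borel (\<lambda>x. f (x /\<^sub>R norm x))"
    unfolding uniform_sphere_def by (simp add: distr_distr o_def)
  also have "\<dots> = distr ?U borel (\<lambda>x. f x /\<^sub>R norm (f x))"
    by (simp add: nrm linear_scale[OF lin])
  also have "\<dots> = distr (distr ?U borel f) borel (\<lambda>x. x /\<^sub>R norm x)"
    by (simp add: distr_distr o_def)
  finally show ?thesis by (simp add: U uniform_sphere_def)
qed

section \<open>Complex reflections\<close>

definition conj_transpose :: "complex ^ 'n ^ 'm \<Rightarrow> complex ^ 'm ^ 'n" where
  "conj_transpose A = map_matrix cnj (transpose A)"

definition unitary_matrix :: "complex ^ 'n ^ 'n \<Rightarrow> bool" where
  "unitary_matrix U \<longleftrightarrow> conj_transpose U ** U = mat 1 \<and> U ** conj_transpose U = mat 1"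

definition complex_reflection :: "complex ^ 'n ^ 'n \<Rightarrow> bool" where
  "complex_reflection R \<longleftrightarrow> unitary_matrix R \<and> rank (mat 1 - R) = 1"

text \<open>The explicit entries of the matrix \<open>P = I - R\<close>.\<close>

definition refl_entry :: "'n \<Rightarrow> complex ^ 'n \<Rightarrow> 'n \<Rightarrow> 'n \<Rightarrow> complex" where
  "refl_entry N x i j =
    (if i \<noteq> N \<and> j \<noteq> N then x $ i * cnj (x $ j) / (1 - cnj (x $ N))
     else if i = N \<and> j \<noteq> N then - ((1 - x $ N) / (1 - cnj (x $ N))) * cnj (x $ j)
     else if i \<noteq> N \<and> j = N then - x $ i
     else 1 - x $ N)"

lemma refl_entry_alt:
  fixes x :: "complex ^ 'n" and N :: 'n
  assumes "x $ N \<noteq> 1"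
  defines "v \<equiv> axis N 1 - x"
  shows "refl_entry N x i j = v $ i * cnj (v $ j) / cnj (v $ N)"
proof -
  have "cnj (x $ N) \<noteq> 1" using assms(1) by (metis complex_cnj_cnj complex_cnj_one)
  then show ?thesis by (auto simp: refl_entry_def v_def axis_def)
qed

lemma unitary_matrix_iff:
  "unitary_matrix U \<longleftrightarrow> (\<forall>i j. (\<Sum>k\<in>UNIV. cnj (U $ k $ i) * U $ k $ j) = (if i = j then 1 else 0))"
proof -
  have "unitary_matrix U \<longleftrightarrow> conj_transpose U ** U = mat 1"
    unfolding unitary_matrix_def using matrix_left_right_inverse by blast
  then show ?thesis
    by (simp add: vec_eq_iff conj_transpose_def matrix_matrix_mult_def transpose_def mat_def)
qed

lemma unitary_minus_iff:
  fixes P :: "complex ^ 'n ^ 'n"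
  shows "unitary_matrix (mat 1 - P) \<longleftrightarrow>
    (\<forall>i j. (\<Sum>k\<in>UNIV. cnj (P $ k $ i) * P $ k $ j) = P $ i $ j + cnj (P $ j $ i))"
proof -
  have key: "(\<Sum>k\<in>UNIV. cnj ((mat 1 - P) $ k $ i) * (mat 1 - P) $ k $ j) =
    (if i = j then 1 else 0) - P $ i $ j - cnj (P $ j $ i)
      + (\<Sum>k\<in>UNIV. cnj (P $ k $ i) * P $ k $ j)" for i j
  proof -
    have "(\<Sum>k\<in>UNIV. cnj ((mat 1 - P) $ k $ i) * (mat 1 - P) $ k $ j) =
      (\<Sum>k\<in>UNIV. (if k = i then (if i = j then 1 else 0) else 0) - (if k = i then P $ k $ j else 0)
         - (if k = j then cnj (P $ k $ i) else 0) + cnj (P $ k $ i) * P $ k $ j)"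
      by (intro sum.cong) (auto simp: mat_def algebra_simps)
    then show ?thesis by (simp add: sum.distrib sum_subtractf)
  qed
  have "(t - a - b + s = t) = (s = a + b)" for t a b s :: complex
    by (auto simp: algebra_simps)
  then show ?thesis unfolding unitary_matrix_iff key by presburger
qed

lemma sum_norm_axis_minus:
  fixes x :: "complex ^ 'n" and N :: 'n
  assumes "norm x = 1"
  defines "v \<equiv> axis N 1 - x"
  shows "(\<Sum>k\<in>UNIV. cnj (v $ k) * v $ k) = v $ N + cnj (v $ N)"
proof -
  have "(norm x)\<^sup>2 = (\<Sum>k\<in>UNIV. (norm (x $ k))\<^sup>2)"
    by (simp add: norm_vec_def L2_set_def sum_nonneg)
  then have "complex_of_real (\<Sum>k\<in>UNIV. (norm (x $ k))\<^sup>2) = 1" using assms(1) by simp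
  then have x1: "(\<Sum>k\<in>UNIV. cnj (x $ k) * x $ k) = 1"
    by (simp add: complex_norm_square mult.commute del: of_real_power)
  have "(\<Sum>k\<in>UNIV. cnj (v $ k) * v $ k) = (\<Sum>k\<in>UNIV. (if k = N then 1 - x $ k - cnj (x $ k) else 0)
      + cnj (x $ k) * x $ k)"
    by (intro sum.cong) (auto simp: v_def axis_def algebra_simps)
  then show ?thesis by (simp add: sum.distrib x1 v_def axis_def)
qed

text \<open>Almost sure existence and uniqueness of the complex reflection sending \<open>e\<^sub>n\<close> to \<open>x\<close>.\<close>

lemma complex_reflection_entries:
  fixes R :: "complex ^ 'n ^ 'n"
  assumes R: "complex_reflection R" "R *v axis N 1 = x" and x: "norm x = 1" "x $ N \<noteq> 1"
  shows "(mat 1 - R) $ i $ j = refl_entry N x i j"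
proof -
  define P where "P = mat 1 - R"
  define v where "v = axis N 1 - x"
  have RP: "R = mat 1 - P" by (simp add: P_def)
  have vN: "v $ N \<noteq> 0" using x(2) by (simp add: v_def axis_def)
  have PN: "P $ k $ N = v $ k" for k
  proof -
    have "x $ k = R $ k $ N"
      using R(2) by (auto simp: matrix_vector_mult_def axis_def if_distrib cong: if_cong)
    then show ?thesis by (auto simp: P_def v_def axis_def mat_def)
  qed
  have "vec.dim (rows P) = 1"
    using R(1) by (simp add: complex_reflection_def P_def row_rank_def_gen)
  then obtain B where B: "rows P \<subseteq> vec.span B" "card B = 1"
    by (metis vec.basis_exists)
  then obtain b where b: "B = {b}" by (auto simp: card_1_singleton_iff)
  have "\<forall>k. \<exists>c. P $ k = c *s b"
  proof
    fix k
    have "P $ k \<in> rows P" by (auto simp: rows_def row_def)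
    then show "\<exists>c. P $ k = c *s b" using B b by (auto simp: vec.span_singleton)
  qed
  then obtain c where c: "\<And>k. P $ k = c k *s b" by metis
  have bN: "b $ N \<noteq> 0" using PN[of N] vN c[of N] by auto
  define d where "d j = b $ j / b $ N" for j
  have P: "P $ k $ j = v $ k * d j" for k j
  proof -
    have "v $ k = c k * b $ N" by (simp add: PN[symmetric] c)
    then show ?thesis using bN by (simp add: c d_def)
  qed
  have "unitary_matrix (mat 1 - P)" using R(1) RP by (simp add: complex_reflection_def)
  then have "(\<Sum>k\<in>UNIV. cnj (P $ k $ N) * P $ k $ j) = P $ N $ j + cnj (P $ j $ N)"
    unfolding unitary_minus_iff by blast
  then have "(\<Sum>k\<in>UNIV. cnj (v $ k) * v $ k) * d j = v $ N * d j + cnj (v $ j)"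
    by (simp add: PN P[of _ j] sum_distrib_right mult.assoc)
  moreover have "(\<Sum>k\<in>UNIV. cnj (v $ k) * v $ k) = v $ N + cnj (v $ N)"
    using sum_norm_axis_minus[OF x(1), of N] by (simp only: v_def)
  ultimately have "cnj (v $ N) * d j = cnj (v $ j)"
    by (simp add: distrib_right)
  then have "d j = cnj (v $ j) / cnj (v $ N)" using vN by (simp add: field_simps)
  then have "P $ i $ j = v $ i * cnj (v $ j) / cnj (v $ N)" by (simp add: P)
  then show ?thesis using refl_entry_alt[OF x(2), of i j] by (simp add: P_def v_def)
qed

lemma complex_reflection_exists:
  fixes x :: "complex ^ 'n"
  assumes x: "norm x = 1" "x $ N \<noteq> 1"
  defines "R \<equiv> mat 1 - (\<chi> i j. refl_entry N x i j)"
  shows "complex_reflection R" "R *v axis N 1 = x"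
proof -
  define v where "v = axis N 1 - x"
  have vN: "v $ N \<noteq> 0" using x(2) by (simp add: v_def axis_def)
  define P where "P = (\<chi> i j. refl_entry N x i j)"
  have P: "P $ i $ j = v $ i * cnj (v $ j) / cnj (v $ N)" for i j
    using refl_entry_alt[OF x(2)] by (simp add: P_def v_def)
  have RP: "R = mat 1 - P" by (simp add: R_def P_def)
  have "unitary_matrix (mat 1 - P)"
    unfolding unitary_minus_iff
  proof (intro allI)
    fix i j
    have "(\<Sum>k\<in>UNIV. cnj (P $ k $ i) * P $ k $ j) =
      (\<Sum>k\<in>UNIV. cnj (v $ k) * v $ k) * (v $ i * cnj (v $ j) / (v $ N * cnj (v $ N)))"
      by (simp add: P sum_divide_distrib sum_distrib_left mult_ac)
    also have "\<dots> = P $ i $ j + cnj (P $ j $ i)"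
      using sum_norm_axis_minus[OF x(1), of N] vN by (simp add: v_def[symmetric] P field_simps)
    finally show "(\<Sum>k\<in>UNIV. cnj (P $ k $ i) * P $ k $ j) = P $ i $ j + cnj (P $ j $ i)" .
  qed
  moreover have "rank P = 1"
  proof -
    define w where "w = P $ N"
    have "w $ N \<noteq> 0" using vN P[of N N] by (simp add: w_def)
    then have w: "w \<noteq> 0" by auto
    have Pi: "P $ i = (v $ i / v $ N) *s w" for i
      using vN by (simp add: vec_eq_iff w_def P)
    have "P $ i \<in> vec.span {w}" for i
      unfolding Pi by (intro vec.span_scale vec.span_base) simp
    then have "rows P \<subseteq> vec.span {w}"
      by (auto simp: rows_def row_def)
    moreover have "{w} \<subseteq> rows P" by (auto simp: rows_def row_def w_def)
    ultimately have "vec.dim (rows P) = 1"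
      using w by (intro vec.dim_unique[of "{w}"]) auto
    then show ?thesis by (simp add: row_rank_def_gen)
  qed
  ultimately show "complex_reflection R"
    by (simp add: complex_reflection_def RP)
  show "R *v axis N 1 = x"
    using vN by (simp add: vec_eq_iff RP matrix_vector_mult_def axis_def if_distrib P mat_def
      cong: if_cong) (auto simp: v_def axis_def)
qed

section \<open>Integrability of the moments\<close>

lemma norm_unitary_entry_le_1:
  assumes "unitary_matrix U"
  shows "norm (U $ i $ j) \<le> 1"
proof -
  have "(\<Sum>k\<in>UNIV. cnj (U $ k $ j) * U $ k $ j) = 1"
    using assms by (simp add: unitary_matrix_iff)
  then have "complex_of_real (\<Sum>k\<in>UNIV. (norm (U $ k $ j))\<^sup>2) = of_real 1"
    by (simp add: complex_norm_square mult.commute del: of_real_power)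
  then have "(\<Sum>k\<in>UNIV. (norm (U $ k $ j))\<^sup>2) = 1"
    by (simp only: of_real_eq_iff)
  moreover have "(norm (U $ i $ j))\<^sup>2 \<le> (\<Sum>k\<in>UNIV. (norm (U $ k $ j))\<^sup>2)"
    by (rule member_le_sum) auto
  ultimately show ?thesis by (simp add: power_le_one_iff abs_square_le_1[of "norm (U $ i $ j)", simplified])
qed

lemma integrable_entry_moment:
  fixes R :: "'w \<Rightarrow> complex ^ 'n ^ 'n"
  assumes "prob_space M" and R: "R \<in> borel_measurable M"
    and AE: "AE \<omega> in M. complex_reflection (R \<omega>)"
  shows "integrable M (\<lambda>\<omega>. (\<Prod>h<m. (mat 1 - R \<omega>) $ (i ! h) $ (j ! h)) *
           cnj (\<Prod>h<l. (mat 1 - R \<omega>) $ (i' ! h) $ (j' ! h)))"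
proof -
  interpret prob_space M by fact
  have ent: "(\<lambda>\<omega>. (mat 1 - R \<omega>) $ a $ b) \<in> borel_measurable M" for a b
    by (rule measurable_compose[OF R borel_measurable_continuous_onI]) (intro continuous_intros)
  have cn: "cnj \<in> borel_measurable borel"
    by (intro borel_measurable_continuous_onI continuous_intros)
  show ?thesis
  proof (rule integrable_const_bound)
    show "AE \<omega> in M. norm ((\<Prod>h<m. (mat 1 - R \<omega>) $ (i ! h) $ (j ! h)) *
           cnj (\<Prod>h<l. (mat 1 - R \<omega>) $ (i' ! h) $ (j' ! h))) \<le> 2 ^ m * 2 ^ l"
      using AE
    proof eventually_elim
      case (elim \<omega>)
      have e: "norm ((mat 1 - R \<omega>) $ a $ b) \<le> 2" for a b
      proof -
        have one: "norm ((mat 1 :: complex ^ 'n ^ 'n) $ a $ b) \<le> 1"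
          by (simp add: mat_def)
        have "norm ((mat 1 - R \<omega>) $ a $ b) \<le> norm ((mat 1 :: complex ^ 'n ^ 'n) $ a $ b) + norm (R \<omega> $ a $ b)"
          by (simp add: norm_triangle_ineq4)
        also have "\<dots> \<le> 1 + 1"
          using elim by (intro add_mono one norm_unitary_entry_le_1) (simp add: complex_reflection_def)
        finally show ?thesis by simp
      qed
      have "(\<Prod>h<k. norm ((mat 1 - R \<omega>) $ f h $ g h)) \<le> 2 ^ k" for k and f g :: "nat \<Rightarrow> 'n"
        using prod_mono[of "{..<k}" "\<lambda>h. norm ((mat 1 - R \<omega>) $ f h $ g h)" "\<lambda>_. 2"] e by simp
      then show ?case
        by (simp only: norm_mult complex_mod_cnj prod_norm[symmetric])
           (intro mult_mono, auto intro!: prod_nonneg)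
    qed
    show "(\<lambda>\<omega>. (\<Prod>h<m. (mat 1 - R \<omega>) $ (i ! h) $ (j ! h)) *
           cnj (\<Prod>h<l. (mat 1 - R \<omega>) $ (i' ! h) $ (j' ! h))) \<in> borel_measurable M"
      by (intro borel_measurable_times borel_measurable_prod ent measurable_compose[OF _ cn])
  qed
qed

end

theory Submission
  imports Defs
begin

text \<open>
  Write \<open>v = e\<^sub>N - X\<close>. The entry \<open>p\<^sub>i\<^sub>j\<close> is \<open>v\<^sub>i\<close> times the conjugate of \<open>v\<^sub>j\<close> divided by the conjugate of
  \<open>v\<^sub>N\<close>. Hence a product of entries and conjugated entries is a monomial in the \<open>v\<^sub>k\<close> and their
  conjugates, with possibly negative exponents at \<open>N\<close>. The uniform distribution is invariant under a change of phase
  of each coordinate \<open>x\<^sub>k\<close>, so the mean vanishes unless for every \<open>k \<noteq> N\<close> the exponents of \<open>v\<^sub>k\<close> and of its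
  conjugate agree (\<open>sphere_mean_entry_weight_charged\<close>). The lengths of the sequences then force agreement at \<open>N\<close>.

  What remains is the mean of \<open>\<Prod>\<^bsub>k \<noteq> N\<^esub> \<bar>x\<^sub>k\<bar>\<close> with exponents \<open>2 \<alpha>\<^sub>k\<close>, times powers with integer exponents
  \<open>s\<close> and \<open>t\<close> of \<open>1 - x\<^sub>N\<close> and of its conjugate. Instead of integrating against the density of \<open>x\<^sub>N\<close> and summing
  a hypergeometric series, the proof uses only symmetries and three relations.

  First, the equation \<open>\<Sum>\<^bsub>k \<noteq> N\<^esub> \<bar>x\<^sub>k\<bar>\<^sup>2 = 1 - \<bar>x\<^sub>N\<bar>\<^sup>2\<close> of the sphere, with the right-hand side written in
  \<open>1 - x\<^sub>N\<close> and its conjugate, is a recurrence in \<open>(\<alpha>, s, t)\<close>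
  (\<open>sphere_mean_reflection_weight_rec\<close>). Second, rotations in the plane of two coordinates \<open>k, j \<noteq> N\<close> make the
  means with one unit of exponent moved from \<open>j\<close> to \<open>k\<close> proportional to each other
  (\<open>abs_monomial_exchange\<close>). Third, if \<open>s = 0\<close> or \<open>t = 0\<close> then the factor in \<open>x\<^sub>N\<close> is
  antiholomorphic or holomorphic and can be replaced by its value at \<open>0\<close> (\<open>sphere_mean_antianalytic\<close>); the remaining
  moment of the sphere follows from the exchange relation as well (\<open>sphere_mean_abs_monomial\<close>).

  These relations determine all the means, by induction on \<open>\<bar>s\<bar> + \<bar>t\<bar>\<close>, and the closed form
  satisfies them (\<open>weight_mean_eq_reflection_moment\<close>).
\<close>

section \<open>Symmetries of the uniform distribution\<close>

abbreviation sphere_mean :: "(complex ^ 'n::finite \<Rightarrow> complex) \<Rightarrow> complex" where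
  "sphere_mean h \<equiv> integral\<^sup>L uniform_sphere h"

lemma sphere_mean_orthogonal:
  fixes f :: "complex ^ 'n::finite \<Rightarrow> complex ^ 'n" and h :: "complex ^ 'n \<Rightarrow> complex"
  assumes f: "orthogonal_transformation f" and h: "h \<in> borel_measurable borel"
  shows "sphere_mean (\<lambda>x. h (f x)) = sphere_mean h"
proof -
  have "f \<in> borel_measurable borel"
    using f by (intro borel_measurable_continuous_onI linear_continuous_on
      linear_conv_bounded_linear[THEN iffD1]) (simp add: orthogonal_transformation)
  then have "f \<in> uniform_sphere \<rightarrow>\<^sub>M borel"
    by (simp cong: measurable_cong_sets)
  from integral_distr[OF this h] show ?thesis
    by (simp add: uniform_sphere_orthogonal_invariant[OF f])
qed

lemma borel_measurable_cnj [measurable]: "cnj \<in> borel_measurable borel"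
  by (intro borel_measurable_continuous_onI continuous_intros)

lemma borel_measurable_vec_nth_complex [measurable]:
  "(\<lambda>x :: complex ^ 'n::finite. x $ k) \<in> borel_measurable borel"
  by (intro borel_measurable_continuous_onI continuous_intros)

definition rotate_coord :: "'n \<Rightarrow> complex \<Rightarrow> complex ^ 'n \<Rightarrow> complex ^ 'n::finite" where
  "rotate_coord k \<omega> x = (\<chi> i. if i = k then \<omega> * x $ i else x $ i)"

lemma rotate_coord_nth: "rotate_coord k \<omega> x $ i = (if i = k then \<omega> * x $ i else x $ i)"
  by (simp add: rotate_coord_def)

lemma orthogonal_rotate_coord:
  assumes "norm \<omega> = 1"
  shows "orthogonal_transformation (rotate_coord k \<omega>)"
proof -
  have "norm (rotate_coord k \<omega> x $ i) = norm (x $ i)" for x i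
    by (simp add: rotate_coord_nth norm_mult assms)
  then have "norm (rotate_coord k \<omega> x) = norm x" for x
    by (simp add: norm_vec_def)
  moreover have "linear (rotate_coord k \<omega>)"
    by (rule linearI) (auto simp: vec_eq_iff rotate_coord_nth algebra_simps)
  ultimately show ?thesis by (simp add: orthogonal_transformation)
qed

text \<open>
  A coordinate phase \<open>\<omega>\<close> leaves the mean unchanged but multiplies \<open>h\<close> by
  \<open>\<omega>\<^sup>r\<close> times the conjugate of \<open>\<omega>\<close> to the power \<open>r'\<close>. With argument \<open>\<pi> / (r - r')\<close> this factor is
  \<open>-1\<close>, so the mean equals its own negative.
\<close>
lemma sphere_mean_charged_zero:
  fixes h :: "complex ^ 'n::finite \<Rightarrow> complex"
  assumes h: "h \<in> borel_measurable borel" and "r \<noteq> r'"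
    and charge: "\<And>\<omega> x. norm \<omega> = 1 \<Longrightarrow> h (rotate_coord k \<omega> x) = \<omega> ^ r * cnj \<omega> ^ r' * h x"
  shows "sphere_mean h = 0"
proof -
  define \<theta> where "\<theta> = pi / (real r - real r')"
  define \<omega> where "\<omega> = cis \<theta>"
  have "\<omega> ^ r = cis (real r * \<theta>)" "cnj \<omega> ^ r' = cis (real r' * - \<theta>)"
    by (simp_all add: \<omega>_def cis_cnj Complex.DeMoivre)
  then have "\<omega> ^ r * cnj \<omega> ^ r' = cis (real r * \<theta> - real r' * \<theta>)"
    by (simp add: cis_mult)
  also have "real r * \<theta> - real r' * \<theta> = (real r - real r') * \<theta>"
    by (simp add: algebra_simps)
  also have "\<dots> = pi"
    using \<open>r \<noteq> r'\<close> by (simp add: \<theta>_def)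
  finally have \<omega>: "\<omega> ^ r * cnj \<omega> ^ r' = -1" by simp
  have n: "norm \<omega> = 1" by (simp add: \<omega>_def)
  have "sphere_mean h = sphere_mean (\<lambda>x. h (rotate_coord k \<omega> x))"
    using sphere_mean_orthogonal[OF orthogonal_rotate_coord[OF n] h] by simp
  also have "\<dots> = sphere_mean (\<lambda>x. - h x)"
    by (simp add: charge[OF n] \<omega>)
  finally show ?thesis by simp
qed

text \<open>
  A real rotation in the plane of two complex coordinates; it is orthogonal when
  \<open>c\<^sup>2 + s\<^sup>2 = 1\<close>. It is the only symmetry, besides the phases, that the moment computation uses.
\<close>
definition mix_coords :: "'n \<Rightarrow> 'n \<Rightarrow> real \<Rightarrow> real \<Rightarrow> complex ^ 'n \<Rightarrow> complex ^ 'n::finite" where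
  "mix_coords k j c s x = (\<chi> i. if i = k then of_real c * x $ k + of_real s * x $ j
     else if i = j then of_real c * x $ j - of_real s * x $ k else x $ i)"

lemma orthogonal_mix_coords:
  assumes "k \<noteq> j" "c\<^sup>2 + s\<^sup>2 = 1"
  shows "orthogonal_transformation (mix_coords k j c s)"
proof -
  have pair: "(norm (of_real c * a + of_real s * b))\<^sup>2 + (norm (of_real c * b - of_real s * a))\<^sup>2
      = (norm a)\<^sup>2 + (norm b)\<^sup>2" for a b :: complex
  proof -
    have "(norm (of_real c * a + of_real s * b))\<^sup>2 + (norm (of_real c * b - of_real s * a))\<^sup>2
      = (c\<^sup>2 + s\<^sup>2) * ((norm a)\<^sup>2 + (norm b)\<^sup>2)"
      unfolding cmod_power2 by (simp add: power2_eq_square algebra_simps)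
    then show ?thesis using assms by simp
  qed
  have split: "(\<Sum>i\<in>UNIV. u i) = u k + u j + (\<Sum>i\<in>UNIV - {k, j}. u i)" for u :: "_ \<Rightarrow> real"
    using assms(1) by (simp add: sum.remove[of UNIV k] sum.remove[of "UNIV - {k}" j] Diff_insert2[symmetric])
  have "norm (mix_coords k j c s x) = norm x" for x
    using assms(1) pair[of "x $ k" "x $ j"]
    by (simp add: norm_vec_def L2_set_def split mix_coords_def)
  moreover have "linear (mix_coords k j c s)"
    by (rule linearI) (auto simp: vec_eq_iff mix_coords_def algebra_simps)
  ultimately show ?thesis by (simp add: orthogonal_transformation)
qed

section \<open>Moments of absolute values\<close>

lemma poly_sum_coeff_zero:
  fixes a :: "nat \<Rightarrow> complex"
  assumes "\<And>y::real. y > 0 \<Longrightarrow> (\<Sum>r\<le>d. a r * of_real y ^ (d - r)) = 0" and "r \<le> d"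
  shows "a r = 0"
proof -
  define p where "p = (\<Sum>i\<le>d. monom (a (d - i)) i)"
  have "poly p (of_real y) = 0" if "y > 0" for y :: real
  proof -
    have "poly p (of_real y) = (\<Sum>i\<le>d. a (d - i) * of_real y ^ i)"
      by (simp add: p_def poly_sum poly_monom)
    also have "\<dots> = (\<Sum>r\<le>d. a r * of_real y ^ (d - r))"
      by (rule sum.reindex_bij_witness[of _ "\<lambda>i. d - i" "\<lambda>i. d - i"]) auto
    finally show ?thesis using assms(1)[OF that] by simp
  qed
  then have "complex_of_real ` {0<..} \<subseteq> {z. poly p z = 0}" by auto
  moreover have "infinite (complex_of_real ` {0<..})"
    by (simp add: finite_image_iff inj_on_def infinite_Ioi)
  ultimately have "p = 0"
    using poly_roots_finite finite_subset by blast
  then have "coeff p (d - r) = 0" by simp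
  then show ?thesis using assms(2) by (simp add: p_def coeff_sum)
qed

text \<open>
  For \<open>c\<^sup>2 + s\<^sup>2 = 1\<close> the mean of \<open>\<bar>c x\<^sub>k + s x\<^sub>j\<bar>\<close> to the power \<open>2 d\<close>, weighted by \<open>g\<close>, is a constant \<open>K\<close>
  by invariance. In the binomial expansion only the terms of equal degree in \<open>x\<^sub>k\<close> and in its conjugate
  have a nonzero mean, which gives
  \<open>\<Sum>\<^sub>r (d choose r)\<^sup>2 c\<^bsup>2r\<^esup> s\<^bsup>2(d-r)\<^esup> M\<^sub>r = K\<close>. With \<open>y = s\<^sup>2/c\<^sup>2\<close> this is an identity between the
  left-hand side and \<open>K (1 + y)\<^sup>d\<close> as polynomials in \<open>y\<close>, and comparing coefficients gives the claim.
\<close>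
lemma pair_moment:
  fixes g :: "complex ^ 'n::finite \<Rightarrow> complex"
  assumes kj: "k \<noteq> j" and g: "g \<in> borel_measurable borel"
    and g_inv: "\<And>x y. (\<And>i. i \<notin> {k, j} \<Longrightarrow> x $ i = y $ i) \<Longrightarrow> g x = g y"
    and int: "integrable uniform_sphere (\<lambda>x. ((norm (x $ k))\<^sup>2 + (norm (x $ j))\<^sup>2) ^ d * norm (g x))"
    and r: "r \<le> d"
  shows "of_nat (d choose r) * sphere_mean (\<lambda>x. (x $ k * cnj (x $ k)) ^ r * (x $ j * cnj (x $ j)) ^ (d - r) * g x)
    = sphere_mean (\<lambda>x. (x $ k * cnj (x $ k)) ^ d * g x)" (is "_ * ?M r = ?K")
proof -
  note [measurable] = g
  define T where "T r r' x = x $ k ^ r * x $ j ^ (d - r) * (cnj (x $ k) ^ r' * cnj (x $ j) ^ (d - r')) * g x"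
    for r r' :: nat and x :: "complex ^ 'n"
  have [measurable]: "T r r' \<in> borel_measurable borel" for r r'
    unfolding T_def by measurable
  have T_int: "integrable uniform_sphere (T r r')" if "r \<le> d" "r' \<le> d" for r r'
  proof (rule Bochner_Integration.integrable_bound[OF int])
    show "T r r' \<in> borel_measurable uniform_sphere" by measurable
    show "AE x in uniform_sphere. norm (T r r' x)
        \<le> norm (((norm (x $ k))\<^sup>2 + (norm (x $ j))\<^sup>2) ^ d * norm (g x))"
    proof (rule AE_I2)
      fix x :: "complex ^ 'n"
      define \<rho> where "\<rho> = sqrt ((norm (x $ k))\<^sup>2 + (norm (x $ j))\<^sup>2)"
      have le: "norm (x $ k) \<le> \<rho>" "norm (x $ j) \<le> \<rho>" "\<rho> \<ge> 0"
        by (auto simp: \<rho>_def intro!: real_le_rsqrt)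
      have half: "norm (x $ k) ^ e * norm (x $ j) ^ (d - e) \<le> \<rho> ^ d" if "e \<le> d" for e
      proof -
        have "norm (x $ k) ^ e * norm (x $ j) ^ (d - e) \<le> \<rho> ^ e * \<rho> ^ (d - e)"
          by (intro mult_mono power_mono le) (auto simp: le)
        then show ?thesis using that by (simp flip: power_add)
      qed
      have "norm (T r r' x) = (norm (x $ k) ^ r * norm (x $ j) ^ (d - r)) *
          (norm (x $ k) ^ r' * norm (x $ j) ^ (d - r')) * norm (g x)"
        by (simp add: T_def norm_mult norm_power)
      also have "\<dots> \<le> (\<rho> ^ d * \<rho> ^ d) * norm (g x)"
        using le that by (intro mult_right_mono mult_mono half) auto
      also have "\<rho> ^ d * \<rho> ^ d = (\<rho>\<^sup>2) ^ d" by (simp add: power2_eq_square power_mult_distrib)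
      also have "\<rho>\<^sup>2 = (norm (x $ k))\<^sup>2 + (norm (x $ j))\<^sup>2" by (simp add: \<rho>_def)
      finally show "norm (T r r' x) \<le> norm (((norm (x $ k))\<^sup>2 + (norm (x $ j))\<^sup>2) ^ d * norm (g x))"
        by simp
    qed
  qed
  have T_off: "sphere_mean (T r r') = 0" if "r \<noteq> r'" for r r'
  proof (rule sphere_mean_charged_zero[OF _ that, where k = k])
    fix \<omega> :: complex and x :: "complex ^ 'n"
    have "g (rotate_coord k \<omega> x) = g x"
      by (rule g_inv) (auto simp: rotate_coord_nth)
    then show "T r r' (rotate_coord k \<omega> x) = \<omega> ^ r * cnj \<omega> ^ r' * T r r' x"
      using kj by (simp add: T_def rotate_coord_nth power_mult_distrib)
  qed measurable
  have T_diag: "sphere_mean (T r r) = ?M r" for r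
    by (rule Bochner_Integration.integral_cong) (auto simp: T_def power_mult_distrib)
  have circle: "(\<Sum>r\<le>d. of_nat (d choose r) ^ 2 * of_real (c\<^sup>2) ^ r * of_real (s\<^sup>2) ^ (d - r) * ?M r) = ?K"
    if cs: "c\<^sup>2 + s\<^sup>2 = 1" for c s :: real
  proof -
    let ?h = "\<lambda>x. (x $ k * cnj (x $ k)) ^ d * g x"
    let ?B = "\<lambda>r. of_nat (d choose r) * of_real c ^ r * of_real s ^ (d - r) :: complex"
    have "?h (mix_coords k j c s x) = (\<Sum>r\<le>d. \<Sum>r'\<le>d. ?B r * ?B r' * T r r' x)" for x
    proof -
      have "g (mix_coords k j c s x) = g x"
        by (rule g_inv) (auto simp: mix_coords_def)
      moreover have "(of_real c * x $ k + of_real s * x $ j) ^ d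
          = (\<Sum>r\<le>d. ?B r * (x $ k ^ r * x $ j ^ (d - r)))"
        by (simp add: binomial_ring power_mult_distrib mult_ac)
      moreover have "cnj (of_real c * x $ k + of_real s * x $ j) ^ d
          = (\<Sum>r'\<le>d. ?B r' * (cnj (x $ k) ^ r' * cnj (x $ j) ^ (d - r')))"
        by (simp add: binomial_ring power_mult_distrib mult_ac)
      ultimately have "?h (mix_coords k j c s x) =
        (\<Sum>r\<le>d. ?B r * (x $ k ^ r * x $ j ^ (d - r))) *
        (\<Sum>r'\<le>d. ?B r' * (cnj (x $ k) ^ r' * cnj (x $ j) ^ (d - r'))) * g x"
        by (simp add: mix_coords_def power_mult_distrib)
      also have "\<dots> = (\<Sum>r\<le>d. \<Sum>r'\<le>d. ?B r * ?B r' * T r r' x)"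
        unfolding sum_product by (simp only: sum_distrib_right T_def) (simp only: mult_ac)
      finally show ?thesis .
    qed
    then have "?K = sphere_mean (\<lambda>x. \<Sum>r\<le>d. \<Sum>r'\<le>d. ?B r * ?B r' * T r r' x)"
      using sphere_mean_orthogonal[OF orthogonal_mix_coords[OF kj cs], of ?h] by simp
    also have "\<dots> = (\<Sum>r\<le>d. \<Sum>r'\<le>d. ?B r * ?B r' * sphere_mean (T r r'))"
      by (subst Bochner_Integration.integral_sum, intro Bochner_Integration.integrable_sum
        integrable_mult_right T_int, simp, simp, intro sum.cong refl)
        (subst Bochner_Integration.integral_sum, auto intro!: integrable_mult_right T_int)
    also have "\<dots> = (\<Sum>r\<le>d. \<Sum>r'\<le>d. if r' = r then ?B r * ?B r * ?M r else 0)"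
      by (intro sum.cong refl) (auto simp: T_off T_diag)
    also have "\<dots> = (\<Sum>r\<le>d. of_nat (d choose r) ^ 2 * of_real (c\<^sup>2) ^ r * of_real (s\<^sup>2) ^ (d - r) * ?M r)"
      by (auto intro!: sum.cong simp: power2_eq_square power_mult_distrib)
    finally show ?thesis by simp
  qed
  have "of_nat (d choose r) ^ 2 * ?M r - of_nat (d choose r) * ?K = 0"
  proof (rule poly_sum_coeff_zero[where d = d, OF _ r])
    fix y :: real assume y: "y > 0"
    \<comment> \<open>The point of the circle with \<open>s\<^sup>2/c\<^sup>2 = y\<close>.\<close>
    have "(\<Sum>r\<le>d. of_nat (d choose r) ^ 2 * of_real (1 / (1 + y)) ^ r * of_real (y / (1 + y)) ^ (d - r) * ?M r) = ?K"
      using circle[of "sqrt (1 / (1 + y))" "sqrt (y / (1 + y))"] y by (simp add: field_simps)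
    then have "of_real (1 + y) ^ d * ?K = (\<Sum>r\<le>d. of_nat (d choose r) ^ 2 * ?M r * of_real y ^ (d - r))"
    proof -
      have p: "of_real (1 + y) ^ d * (of_nat (d choose r) ^ 2 * of_real (1 / (1 + y)) ^ r * of_real (y / (1 + y)) ^ (d - r) * ?M r)
        = of_nat (d choose r) ^ 2 * ?M r * of_real y ^ (d - r)" if "r \<le> d" for r
      proof -
        have nz: "complex_of_real (1 + y) \<noteq> 0" using y by (simp flip: of_real_add add: of_real_eq_0_iff del: of_real_add)
        have "complex_of_real (1 + y) ^ d = of_real (1 + y) ^ r * of_real (1 + y) ^ (d - r)"
          using that by (simp flip: power_add)
        then show ?thesis using nz
          by (simp add: power_divide del: of_real_add)
      qed
      assume "(\<Sum>r\<le>d. of_nat (d choose r) ^ 2 * of_real (1 / (1 + y)) ^ r * of_real (y / (1 + y)) ^ (d - r) * ?M r) = ?K"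
      from this[symmetric] show ?thesis
        by (simp only: sum_distrib_left) (intro sum.cong refl p, simp)
    qed
    moreover have "complex_of_real (1 + y) ^ d = (\<Sum>r\<le>d. of_nat (d choose r) * of_real y ^ (d - r))"
      using binomial_ring[of 1 "complex_of_real y" d] by simp
    ultimately show "(\<Sum>r\<le>d. (of_nat (d choose r) ^ 2 * ?M r - of_nat (d choose r) * ?K) * of_real y ^ (d - r)) = 0"
      by (simp add: left_diff_distrib right_diff_distrib sum_subtractf sum_distrib_left sum_distrib_right mult_ac)
  qed
  then have "of_nat (d choose r) * (of_nat (d choose r) * ?M r - ?K) = 0"
    by (simp add: power2_eq_square algebra_simps)
  then show ?thesis using r by simp
qed

definition abs_monomial :: "'n set \<Rightarrow> ('n \<Rightarrow> nat) \<Rightarrow> complex ^ 'n::finite \<Rightarrow> complex" where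
  "abs_monomial S \<beta> x = (\<Prod>k\<in>S. (x $ k * cnj (x $ k)) ^ \<beta> k)"

abbreviation bump :: "('n \<Rightarrow> nat) \<Rightarrow> 'n \<Rightarrow> 'n \<Rightarrow> nat" where
  "bump \<beta> k \<equiv> \<beta>(k := Suc (\<beta> k))"

lemma borel_measurable_abs_monomial [measurable]:
  "abs_monomial S \<beta> \<in> borel_measurable (borel :: (complex ^ 'n::finite) measure)"
  unfolding abs_monomial_def by measurable

lemma abs_monomial_bump:
  fixes S :: "'n::finite set"
  assumes "k \<in> S"
  shows "abs_monomial S (bump \<beta> k) x = x $ k * cnj (x $ k) * abs_monomial S \<beta> x"
  using assms by (simp add: abs_monomial_def prod.remove[of S k] mult_ac)

lemma prod_fact_bump:
  fixes S :: "'n::finite set"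
  assumes "k \<in> S"
  shows "(\<Prod>i\<in>S. fact (bump \<beta> k i)) = (of_nat (Suc (\<beta> k)) * (\<Prod>i\<in>S. fact (\<beta> i)) :: complex)"
  using assms by (simp add: prod.remove[of S k] mult_ac)

lemma sum_bump:
  fixes S :: "'n::finite set"
  assumes "k \<in> S"
  shows "sum (bump \<beta> k) S = Suc (sum \<beta> S)"
  using assms by (simp add: sum.remove[of S k])

lemma ex_bump:
  fixes S :: "'n::finite set"
  assumes "sum \<beta> S > 0"
  obtains j \<gamma> where "j \<in> S" "\<beta> = bump \<gamma> j"
proof -
  obtain j where j: "j \<in> S" "\<beta> j > 0"
    using assms by (metis gr0I not_less_zero sum.neutral)
  then have "\<beta> = bump (\<beta>(j := \<beta> j - 1)) j" by auto
  with j(1) show thesis by (rule that)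
qed

lemma norm_abs_monomial_le:
  fixes S :: "'n::finite set"
  assumes "S \<subseteq> T"
  shows "norm (abs_monomial S \<beta> x) \<le> (\<Sum>i\<in>T. (norm (x $ i))\<^sup>2) ^ sum \<beta> S"
proof -
  have "norm (abs_monomial S \<beta> x) = (\<Prod>k\<in>S. ((norm (x $ k))\<^sup>2) ^ \<beta> k)"
    by (simp add: abs_monomial_def norm_mult norm_power power2_eq_square flip: prod_norm)
  also have "\<dots> \<le> (\<Prod>k\<in>S. (\<Sum>i\<in>T. (norm (x $ i))\<^sup>2) ^ \<beta> k)"
    using assms by (intro prod_mono conjI power_mono member_le_sum) auto
  also have "\<dots> = (\<Sum>i\<in>T. (norm (x $ i))\<^sup>2) ^ sum \<beta> S"
    by (simp add: power_sum)
  finally show ?thesis .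
qed

lemma cross_cancel:
  fixes a b c c' u v :: "'a::field"
  assumes "c * u = c' * v" "a * c' = b * c" "c' \<noteq> 0"
  shows "a * u = b * v"
proof -
  have "c' * (a * u) = (a * c') * u" by (simp only: mult_ac)
  also have "\<dots> = b * (c * u)" by (simp only: assms(2) mult_ac)
  also have "\<dots> = c' * (b * v)" by (simp only: assms(1) mult_ac)
  finally show ?thesis using assms(3) by simp
qed

text \<open>
  The moments with total exponent \<open>d\<close> in the two coordinates \<open>k\<close> and \<open>j\<close> are inversely proportional to
  the binomial coefficients, so moving one unit of exponent from \<open>j\<close> to \<open>k\<close> changes the mean by the
  ratio of two neighbouring binomial coefficients. The set \<open>S\<close> will be the set of all coordinates, with
  \<open>g = 1\<close>, and the set of all coordinates except \<open>N\<close>, with \<open>g\<close> a function of the coordinate \<open>N\<close>.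
\<close>
lemma abs_monomial_exchange:
  fixes g :: "complex ^ 'n::finite \<Rightarrow> complex"
  assumes kS: "k \<in> S" and jS: "j \<in> S" and g: "g \<in> borel_measurable borel"
    and g_inv: "\<And>x y. (\<And>i. i \<notin> S \<Longrightarrow> x $ i = y $ i) \<Longrightarrow> g x = g y"
    and int: "integrable uniform_sphere (\<lambda>x. (\<Sum>i\<in>S. (norm (x $ i))\<^sup>2) ^ Suc (sum \<beta> S) * norm (g x))"
  shows "of_nat (Suc (\<beta> k)) * sphere_mean (\<lambda>x. abs_monomial S (bump \<beta> j) x * g x)
    = of_nat (Suc (\<beta> j)) * sphere_mean (\<lambda>x. abs_monomial S (bump \<beta> k) x * g x)"
proof (cases "k = j")
  case False
  note [measurable] = g
  define T where "T = S - {k, j}"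
  define g' where "g' x = abs_monomial T \<beta> x * g x" for x
  let ?d = "Suc (\<beta> k + \<beta> j)"
  let ?M = "\<lambda>r. sphere_mean (\<lambda>x. (x $ k * cnj (x $ k)) ^ r * (x $ j * cnj (x $ j)) ^ (?d - r) * g' x)"
  have split: "(\<Prod>i\<in>S. u i) = u k * (u j * (\<Prod>i\<in>T. u i))" for u :: "'n \<Rightarrow> complex"
    using kS jS False unfolding T_def
    by (simp add: prod.remove[of S k] prod.remove[of "S - {k}" j] Diff_insert2[symmetric])
  have split_sum: "(\<Sum>i\<in>S. u i) = u k + (u j + (\<Sum>i\<in>T. u i))" for u :: "'n \<Rightarrow> 'b::comm_monoid_add"
    using kS jS False unfolding T_def
    by (simp add: sum.remove[of S k] sum.remove[of "S - {k}" j] Diff_insert2[symmetric])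
  have T_bump: "abs_monomial T (bump \<beta> i) x = abs_monomial T \<beta> x" if "i \<in> {k, j}" for i x
    unfolding abs_monomial_def using that by (intro prod.cong) (auto simp: T_def)
  have g'_inv: "g' x = g' y" if "\<And>i. i \<notin> {k, j} \<Longrightarrow> x $ i = y $ i" for x y
  proof -
    have "g x = g y" using kS jS by (intro g_inv that) auto
    moreover have "abs_monomial T \<beta> x = abs_monomial T \<beta> y"
      unfolding abs_monomial_def using that by (intro prod.cong) (auto simp: T_def)
    ultimately show ?thesis by (simp add: g'_def)
  qed
  have int': "integrable uniform_sphere
      (\<lambda>x. ((norm (x $ k))\<^sup>2 + (norm (x $ j))\<^sup>2) ^ ?d * norm (g' x))"
  proof (rule Bochner_Integration.integrable_bound[OF int])
    show "(\<lambda>x. ((norm (x $ k))\<^sup>2 + (norm (x $ j))\<^sup>2) ^ ?d * norm (g' x)) \<in> borel_measurable uniform_sphere"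
      unfolding g'_def by measurable
    show "AE x in uniform_sphere. norm (((norm (x $ k))\<^sup>2 + (norm (x $ j))\<^sup>2) ^ ?d * norm (g' x))
        \<le> norm ((\<Sum>i\<in>S. (norm (x $ i))\<^sup>2) ^ Suc (sum \<beta> S) * norm (g x))"
    proof (rule AE_I2)
      fix x :: "complex ^ 'n"
      let ?\<sigma> = "\<Sum>i\<in>S. (norm (x $ i))\<^sup>2"
      have "((norm (x $ k))\<^sup>2 + (norm (x $ j))\<^sup>2) ^ ?d * norm (abs_monomial T \<beta> x)
          \<le> ?\<sigma> ^ ?d * ?\<sigma> ^ sum \<beta> T"
        by (intro mult_mono power_mono norm_abs_monomial_le)
          (auto simp: split_sum sum_nonneg T_def)
      also have "\<dots> = ?\<sigma> ^ Suc (sum \<beta> S)"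
        by (simp add: split_sum[of \<beta>] power_add[symmetric] add_ac)
      finally have "((norm (x $ k))\<^sup>2 + (norm (x $ j))\<^sup>2) ^ ?d * norm (abs_monomial T \<beta> x) * norm (g x)
          \<le> ?\<sigma> ^ Suc (sum \<beta> S) * norm (g x)"
        by (intro mult_right_mono) auto
      then show "norm (((norm (x $ k))\<^sup>2 + (norm (x $ j))\<^sup>2) ^ ?d * norm (g' x))
        \<le> norm (?\<sigma> ^ Suc (sum \<beta> S) * norm (g x))"
        by (simp add: g'_def norm_mult mult_ac sum_nonneg)
    qed
  qed
  have g'_meas: "g' \<in> borel_measurable borel" unfolding g'_def by measurable
  note pm = pair_moment[OF False g'_meas g'_inv int']
  have "of_nat (?d choose \<beta> k) * ?M (\<beta> k) = of_nat (?d choose Suc (\<beta> k)) * ?M (Suc (\<beta> k))"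
    using pm[of "\<beta> k"] pm[of "Suc (\<beta> k)"] by simp
  moreover have "of_nat (Suc (\<beta> k)) * of_nat (?d choose Suc (\<beta> k))
      = (of_nat (Suc (\<beta> j)) * of_nat (?d choose \<beta> k) :: complex)"
    using Suc_times_binomial_add[of "\<beta> k" "\<beta> j"] by (metis of_nat_mult)
  moreover have "(of_nat (?d choose Suc (\<beta> k)) :: complex) \<noteq> 0"
    by (simp del: binomial_Suc_Suc)
  ultimately have M: "of_nat (Suc (\<beta> k)) * ?M (\<beta> k) = of_nat (Suc (\<beta> j)) * ?M (Suc (\<beta> k))"
    by (rule cross_cancel)
  have "abs_monomial S \<gamma> x = (x $ k * cnj (x $ k)) ^ \<gamma> k * ((x $ j * cnj (x $ j)) ^ \<gamma> j * abs_monomial T \<gamma> x)"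
    for \<gamma> and x :: "complex ^ 'n"
    by (simp only: abs_monomial_def split)
  then have "abs_monomial S (bump \<beta> j) x * g x
        = (x $ k * cnj (x $ k)) ^ \<beta> k * (x $ j * cnj (x $ j)) ^ (?d - \<beta> k) * g' x"
      "abs_monomial S (bump \<beta> k) x * g x
        = (x $ k * cnj (x $ k)) ^ Suc (\<beta> k) * (x $ j * cnj (x $ j)) ^ (?d - Suc (\<beta> k)) * g' x" for x
    using False T_bump[of k x] T_bump[of j x] by (simp_all add: g'_def mult.assoc del: power_Suc)
  then show ?thesis using M by simp
qed simp

text \<open>
  Summing the exchange relation over \<open>k\<close>: one raised moment is determined by the sum of all of them,
  and that sum can be evaluated by a relation such as \<open>\<Sum>\<^sub>k \<bar>x\<^sub>k\<bar>\<^sup>2 = 1\<close>.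
\<close>
lemma abs_monomial_bump_sum:
  fixes g :: "complex ^ 'n::finite \<Rightarrow> complex"
  assumes "j \<in> S" and "g \<in> borel_measurable borel"
    and "\<And>x y. (\<And>i. i \<notin> S \<Longrightarrow> x $ i = y $ i) \<Longrightarrow> g x = g y"
    and "integrable uniform_sphere (\<lambda>x. (\<Sum>i\<in>S. (norm (x $ i))\<^sup>2) ^ Suc (sum \<beta> S) * norm (g x))"
  shows "of_nat (card S + sum \<beta> S) * sphere_mean (\<lambda>x. abs_monomial S (bump \<beta> j) x * g x)
    = of_nat (Suc (\<beta> j)) * (\<Sum>k\<in>S. sphere_mean (\<lambda>x. abs_monomial S (bump \<beta> k) x * g x))"
proof -
  have "of_nat (card S + sum \<beta> S) = (\<Sum>k\<in>S. of_nat (Suc (\<beta> k)) :: complex)"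
    by (simp add: sum.distrib)
  then have "of_nat (card S + sum \<beta> S) * sphere_mean (\<lambda>x. abs_monomial S (bump \<beta> j) x * g x)
      = (\<Sum>k\<in>S. of_nat (Suc (\<beta> k)) * sphere_mean (\<lambda>x. abs_monomial S (bump \<beta> j) x * g x))"
    by (simp only: sum_distrib_right)
  also have "\<dots> = (\<Sum>k\<in>S. of_nat (Suc (\<beta> j)) * sphere_mean (\<lambda>x. abs_monomial S (bump \<beta> k) x * g x))"
    by (intro sum.cong refl abs_monomial_exchange assms)
  finally show ?thesis by (simp only: sum_distrib_left)
qed

lemma finite_measure_uniform_sphere: "finite_measure (uniform_sphere :: 'a::euclidean_space measure)"
  by (rule prob_space.finite_measure[OF prob_space_uniform_sphere])

lemma integrable_uniform_sphere_bounded: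
  fixes h :: "complex ^ 'n::finite \<Rightarrow> 'b::{banach, second_countable_topology}"
  assumes "h \<in> borel_measurable borel"
    and "\<And>x. norm x = 1 \<Longrightarrow> x $ N \<noteq> 1 \<Longrightarrow> norm (h x) \<le> B"
  shows "integrable uniform_sphere h"
proof (rule finite_measure.integrable_const_bound[OF finite_measure_uniform_sphere, where B = B])
  show "AE x in uniform_sphere. norm (h x) \<le> B"
    using AE_uniform_sphere_norm AE_uniform_sphere_nth_neq_1[of N] by eventually_elim (rule assms(2))
qed (use assms(1) in simp)

lemma sphere_mean_cong:
  fixes h h' :: "complex ^ 'n::finite \<Rightarrow> complex"
  assumes "h \<in> borel_measurable borel" "h' \<in> borel_measurable borel"
    and "\<And>x. norm x = 1 \<Longrightarrow> x $ N \<noteq> 1 \<Longrightarrow> h x = h' x"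
  shows "sphere_mean h = sphere_mean h'"
proof (rule integral_cong_AE)
  show "AE x in uniform_sphere. h x = h' x"
    using AE_uniform_sphere_norm AE_uniform_sphere_nth_neq_1[of N] by eventually_elim (rule assms(3))
qed (use assms(1,2) in simp_all)

lemma sum_norm_squares: "(\<Sum>i\<in>UNIV. (norm (x $ i))\<^sup>2) = (norm (x :: complex ^ 'n::finite))\<^sup>2"
  by (simp add: norm_vec_def L2_set_def sum_nonneg)

lemma sum_norm_squares_minus:
  fixes x :: "complex ^ 'n::finite"
  assumes "norm x = 1"
  shows "(\<Sum>i\<in>UNIV - {N}. (norm (x $ i))\<^sup>2) = 1 - (norm (x $ N))\<^sup>2"
  using sum_norm_squares[of x] assms by (simp add: sum.remove[of UNIV N])

text \<open>
  Multiplying the monomial of exponent \<open>\<gamma>\<close> by \<open>1 = \<Sum>\<^sub>k \<bar>x\<^sub>k\<bar>\<^sup>2\<close> expresses its mean by the means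
  with one exponent raised, all of which are proportional to each other.
\<close>
lemma sphere_mean_abs_monomial:
  fixes \<beta> :: "'n::finite \<Rightarrow> nat"
  shows "sphere_mean (abs_monomial UNIV \<beta>)
    = (\<Prod>k\<in>UNIV. fact (\<beta> k)) / pochhammer (of_nat CARD('n)) (sum \<beta> UNIV)"
proof (induction "sum \<beta> UNIV" arbitrary: \<beta>)
  case 0
  have "measure (uniform_sphere :: (complex ^ 'n) measure) (space uniform_sphere) = 1"
    using prob_space.prob_space[OF prob_space_uniform_sphere] .
  moreover have "\<beta> = (\<lambda>_. 0)" using 0 by (auto simp: fun_eq_iff)
  ultimately show ?case by (simp add: abs_monomial_def[abs_def])
next
  case (Suc A)
  then obtain j \<gamma> where \<beta>: "\<beta> = bump \<gamma> j" by (metis ex_bump zero_less_Suc)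
  have A: "sum \<gamma> UNIV = A" using Suc.hyps(2) by (simp add: \<beta> sum_bump del: fun_upd_apply)
  have bound: "norm (abs_monomial UNIV \<delta> x) \<le> 1" if "norm x = 1" for \<delta> and x :: "complex ^ 'n"
    using norm_abs_monomial_le[of UNIV UNIV \<delta> x] that by (simp add: sum_norm_squares)
  have "abs_monomial UNIV \<gamma> x = (\<Sum>k\<in>UNIV. abs_monomial UNIV (bump \<gamma> k) x)"
    if "norm x = 1" for x :: "complex ^ 'n"
  proof -
    have "(\<Sum>k\<in>UNIV. x $ k * cnj (x $ k)) = of_real (\<Sum>k\<in>UNIV. (norm (x $ k))\<^sup>2)"
      by (simp add: complex_norm_square del: of_real_power)
    also have "\<dots> = 1" by (simp add: sum_norm_squares that)
    finally show ?thesis by (simp add: abs_monomial_bump flip: sum_distrib_right)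
  qed
  then have "sphere_mean (abs_monomial UNIV \<gamma>) = sphere_mean (\<lambda>x. \<Sum>k\<in>UNIV. abs_monomial UNIV (bump \<gamma> k) x)"
    by (intro sphere_mean_cong[where N = j] borel_measurable_sum borel_measurable_abs_monomial)
  also have "\<dots> = (\<Sum>k\<in>UNIV. sphere_mean (abs_monomial UNIV (bump \<gamma> k)))"
    by (intro Bochner_Integration.integral_sum integrable_uniform_sphere_bounded[where B = 1] bound) auto
  finally have "of_nat (CARD('n) + A) * sphere_mean (abs_monomial UNIV \<beta>)
      = of_nat (Suc (\<gamma> j)) * sphere_mean (abs_monomial UNIV \<gamma>)"
    using abs_monomial_bump_sum[of j UNIV "\<lambda>_. 1" \<gamma>] integrable_uniform_sphere_bounded[where B = 1, 
       of "\<lambda>x :: complex ^ 'n. (\<Sum>i\<in>UNIV. (norm (x $ i))\<^sup>2) ^ Suc A"]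
    by (simp add: A \<beta> sum_norm_squares del: fun_upd_apply)
  moreover have "of_nat (CARD('n) + A) \<noteq> (0 :: complex)" by (simp flip: of_nat_add)
  ultimately have "sphere_mean (abs_monomial UNIV \<beta>)
      = of_nat (Suc (\<gamma> j)) * sphere_mean (abs_monomial UNIV \<gamma>) / of_nat (CARD('n) + A)"
    by (simp add: field_simps)
  then show ?case
    unfolding Suc.hyps(1)[OF A[symmetric]] Suc.hyps(2)[symmetric] A
    by (simp add: \<beta> prod_fact_bump pochhammer_Suc mult_ac del: fun_upd_apply)
qed

section \<open>The base case: antiholomorphic factors\<close>

text \<open>
  On the unit sphere \<open>1 - \<bar>x\<^sub>N\<bar>\<^sup>2 \<le> 2 \<bar>1 - x\<^sub>N\<bar>\<close>, so a product of squares \<open>\<bar>x\<^sub>k\<bar>\<^sup>2\<close> with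
  \<open>k \<noteq> N\<close> compensates a pole at \<open>x\<^sub>N = 1\<close> whose order is at most the number of factors. The integrability
  claims below rest on this bound.
\<close>
lemma pole_bound:
  fixes x :: "complex ^ 'n::finite"
  assumes x: "norm x = 1" "x $ N \<noteq> 1" and s: "int D + s \<ge> 0"
  shows "(1 - (norm (x $ N))\<^sup>2) ^ D * norm (1 - x $ N) powi s \<le> 2 ^ D * 2 powi (int D + s)"
proof -
  have le1: "norm (x $ N) \<le> 1" using Finite_Cartesian_Product.norm_nth_le[of x N] x(1) by simp
  have v: "norm (1 - x $ N) > 0" "norm (1 - x $ N) \<le> 2"
    using x(2) le1 norm_triangle_ineq4[of 1 "x $ N"] by auto
  have "1 - (norm (x $ N))\<^sup>2 = (1 + norm (x $ N)) * (1 - norm (x $ N))"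
    by (simp add: power2_eq_square algebra_simps)
  also have "\<dots> \<le> 2 * norm (1 - x $ N)"
    using le1 norm_triangle_ineq2[of 1 "x $ N"] by (intro mult_mono) auto
  finally have "(1 - (norm (x $ N))\<^sup>2) ^ D * norm (1 - x $ N) powi s
      \<le> (2 * norm (1 - x $ N)) ^ D * norm (1 - x $ N) powi s"
    using le1 by (intro mult_right_mono power_mono) (auto simp: power_le_one)
  also have "\<dots> = 2 ^ D * norm (1 - x $ N) powi (int D + s)"
    using v by (simp add: power_mult_distrib power_int_add)
  also have "\<dots> \<le> 2 ^ D * 2 powi (int D + s)"
    using v s by (intro mult_left_mono power_int_mono) auto
  finally show ?thesis .
qed

lemma norm_abs_monomial_minus_le:
  fixes x :: "complex ^ 'n::finite"
  assumes "norm x = 1"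
  shows "norm (abs_monomial (UNIV - {N}) \<alpha> x) \<le> (1 - (norm (x $ N))\<^sup>2) ^ sum \<alpha> (UNIV - {N})"
  using norm_abs_monomial_le[of "UNIV - {N}" "UNIV - {N}" \<alpha> x] by (simp add: sum_norm_squares_minus assms)

lemma abs_monomial_rotate_coord:
  assumes "k \<notin> S"
  shows "abs_monomial S \<beta> (rotate_coord k \<omega> x) = abs_monomial S \<beta> x"
  unfolding abs_monomial_def using assms by (intro prod.cong) (auto simp: rotate_coord_nth)

text \<open>
  An antiholomorphic factor in \<open>x\<^sub>N\<close> acts on the mean like its value at \<open>0\<close>, as in the mean value property. For
  polynomials this holds because a positive power is not invariant under a phase change of \<open>x\<^sub>N\<close>. A pole is removed by \<open>1/(1-u) = (1 + u + \<dots> + u\<^bsup>K-1\<^esup>) + u\<^sup>K/(1-u)\<close>: the first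
  summand lowers the order of the pole and has value \<open>1\<close> at \<open>0\<close>, and the mean of the second tends
  to \<open>0\<close> as \<open>K\<close> grows. Since the mean of the second summand is the same
  for all \<open>K \<ge> 1\<close>, it vanishes.
\<close>
lemma sphere_mean_antianalytic:
  fixes N :: "'n::finite" and Q :: "complex poly"
  assumes "p \<le> sum \<alpha> (UNIV - {N})"
  shows "sphere_mean (\<lambda>x. abs_monomial (UNIV - {N}) \<alpha> x * (poly Q (cnj (x $ N)) / (1 - cnj (x $ N)) ^ p))
    = poly Q 0 * sphere_mean (abs_monomial (UNIV - {N}) \<alpha>)"
proof -
  let ?A = "sum \<alpha> (UNIV - {N})" and ?w = "abs_monomial (UNIV - {N}) \<alpha>"
  define F where "F Q p x = ?w x * (poly Q (cnj (x $ N)) / (1 - cnj (x $ N)) ^ p)" for Q p and x :: "complex ^ 'n"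
  have poly_meas: "poly Q \<in> borel_measurable borel" for Q :: "complex poly"
    by (intro borel_measurable_continuous_onI continuous_intros)
  have F_meas [measurable]: "F Q p \<in> borel_measurable borel" for Q p
    unfolding F_def using poly_meas[of Q, measurable] by measurable
  have bound: "\<exists>B. \<forall>x. norm x = 1 \<longrightarrow> x $ N \<noteq> 1 \<longrightarrow> norm (F Q p x) \<le> B" if "p \<le> ?A" for Q p
  proof -
    have "bounded (poly Q ` cball 0 1)"
      by (intro compact_imp_bounded compact_continuous_image continuous_intros compact_cball)
    then obtain C where "\<forall>y \<in> poly Q ` cball 0 1. norm y \<le> C"
      unfolding bounded_iff by blast
    then have C: "norm (poly Q u) \<le> C" if "norm u \<le> 1" for u
      using that by auto
    have "norm (F Q p x) \<le> 2 ^ ?A * 2 powi (int ?A + - int p) * C" if x: "norm x = 1" "x $ N \<noteq> 1" for x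
    proof -
      have "norm (?w x) * norm (1 - x $ N) powi (- int p)
          \<le> (1 - (norm (x $ N))\<^sup>2) ^ ?A * norm (1 - x $ N) powi (- int p)"
        by (intro mult_right_mono norm_abs_monomial_minus_le x) auto
      also have "\<dots> \<le> 2 ^ ?A * 2 powi (int ?A + - int p)"
        using \<open>p \<le> ?A\<close> by (intro pole_bound x) (simp del: of_nat_sum)
      finally have 1: "norm (?w x) * norm (1 - x $ N) powi (- int p) \<le> 2 ^ ?A * 2 powi (int ?A + - int p)" .
      have "norm (1 - cnj (x $ N)) = norm (1 - x $ N)"
        by (metis complex_cnj_diff complex_cnj_one complex_mod_cnj)
      then have "norm (F Q p x) = norm (?w x) * norm (1 - x $ N) powi (- int p) * norm (poly Q (cnj (x $ N)))"
        by (simp add: F_def norm_mult norm_divide norm_power norm_inverse power_int_minus divide_inverse)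
      also have "\<dots> \<le> 2 ^ ?A * 2 powi (int ?A + - int p) * C"
        using Finite_Cartesian_Product.norm_nth_le[of x N] x(1) by (intro mult_mono 1 C) auto
      finally show ?thesis .
    qed
    then show ?thesis by blast
  qed
  have F_int: "integrable uniform_sphere (F Q p)" if "p \<le> ?A" for Q p
    using bound[OF that, of Q] integrable_uniform_sphere_bounded[OF F_meas, of N] by blast
  have "sphere_mean (F Q p) = poly Q 0 * sphere_mean ?w"
    using assms
  proof (induction p arbitrary: Q)
    case 0
    have charge: "sphere_mean (\<lambda>x. ?w x * cnj (x $ N) ^ i) = (if i = 0 then sphere_mean ?w else 0)" for i
      using sphere_mean_charged_zero[of "\<lambda>x. ?w x * cnj (x $ N) ^ i" 0 i N]
      by (auto simp: abs_monomial_rotate_coord rotate_coord_nth power_mult_distrib mult_ac)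
    have int: "integrable uniform_sphere (\<lambda>x. ?w x * cnj (x $ N) ^ i)" for i
      using F_int[of 0 "monom 1 i"] by (simp add: F_def[abs_def] poly_monom)
    have "sphere_mean (F Q 0) = sphere_mean (\<lambda>x. \<Sum>i\<le>degree Q. coeff Q i * (?w x * cnj (x $ N) ^ i))"
      by (simp add: F_def[abs_def] poly_altdef sum_distrib_left mult_ac)
    also have "\<dots> = (\<Sum>i\<le>degree Q. coeff Q i * (if i = 0 then sphere_mean ?w else 0))"
      by (subst Bochner_Integration.integral_sum) (auto simp: int charge)
    also have "\<dots> = poly Q 0 * sphere_mean ?w"
      by (simp add: if_distrib poly_0_coeff_0 cong: if_cong)
    finally show ?case .
  next
    case (Suc p)
    define S :: "nat \<Rightarrow> complex poly" where "S K = (\<Sum>i<K. monom 1 i)" for K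
    have S: "poly (S K) u = (\<Sum>i<K. u ^ i)" for K u by (simp add: S_def poly_sum poly_monom)
    let ?R = "\<lambda>K x. cnj (x $ N) ^ K * F Q (Suc p) x"
    obtain B where B: "\<And>x. norm x = 1 \<Longrightarrow> x $ N \<noteq> 1 \<Longrightarrow> norm (F Q (Suc p) x) \<le> B"
      using bound[OF Suc.prems, of Q] by blast
    have R_bound: "norm (?R K x) \<le> B" if "norm x = 1" "x $ N \<noteq> 1" for K and x :: "complex ^ 'n"
    proof -
      have "norm (?R K x) \<le> 1 * B"
        unfolding norm_mult norm_power complex_mod_cnj
        using Finite_Cartesian_Product.norm_nth_le[of x N] that by (intro mult_mono power_le_one B) auto
      then show ?thesis by simp
    qed
    have R_int: "integrable uniform_sphere (?R K)" for K
      by (rule integrable_uniform_sphere_bounded[OF _ R_bound]) measurable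
    have split: "sphere_mean (F Q (Suc p)) - poly Q 0 * sphere_mean ?w = sphere_mean (?R (Suc K))" for K
    proof -
      have "sphere_mean (F Q (Suc p)) = sphere_mean (\<lambda>x. F (Q * S (Suc K)) p x + ?R (Suc K) x)"
      proof (rule sphere_mean_cong)
        fix x :: "complex ^ 'n" assume "norm x = 1" "x $ N \<noteq> 1"
        define u where "u = cnj (x $ N)"
        have u: "1 - u \<noteq> 0" using \<open>x $ N \<noteq> 1\<close> unfolding u_def
          by (metis complex_cnj_cnj complex_cnj_one eq_iff_diff_eq_0)
        have "poly (S (Suc K)) u = (1 - u ^ Suc K) / (1 - u)"
          using u one_diff_power_eq[of u "Suc K"] by (simp add: S field_simps del: power_Suc sum.lessThan_Suc)
        then have "F (Q * S (Suc K)) p x = (1 - u ^ Suc K) * F Q (Suc p) x"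
          using u by (simp add: F_def mult_ac flip: u_def)
        then show "F Q (Suc p) x = F (Q * S (Suc K)) p x + ?R (Suc K) x"
          by (simp add: algebra_simps u_def del: power_Suc)
      qed measurable
      also have "\<dots> = sphere_mean (F (Q * S (Suc K)) p) + sphere_mean (?R (Suc K))"
        using Suc.prems by (intro Bochner_Integration.integral_add F_int R_int) auto
      also have "sphere_mean (F (Q * S (Suc K)) p) = poly Q 0 * sphere_mean ?w"
      proof -
        have "(\<Sum>i<Suc K. (0::complex) ^ i) = 1" by (induction K) auto
        then show ?thesis using Suc by (simp add: S del: sum.lessThan_Suc)
      qed
      finally show ?thesis by simp
    qed
    have "(\<lambda>K. sphere_mean (?R K)) \<longlonglongrightarrow> sphere_mean (\<lambda>x :: complex ^ 'n. 0)"
    proof (rule integral_dominated_convergence[where w = "\<lambda>_. B"])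
      show "integrable uniform_sphere (\<lambda>_ :: complex ^ 'n. B)"
        by (rule integrable_uniform_sphere_bounded[where B = "norm B"]) auto
      show "AE x in uniform_sphere. norm (?R K x) \<le> B" for K
        using AE_uniform_sphere_norm AE_uniform_sphere_nth_neq_1[of N] by eventually_elim (rule R_bound)
      show "AE x in uniform_sphere. (\<lambda>K. ?R K x) \<longlonglongrightarrow> 0"
        using AE_uniform_sphere_norm
      proof eventually_elim
        case (elim x)
        have le1: "norm (x $ N) \<le> 1" using Finite_Cartesian_Product.norm_nth_le[of x N] elim by simp
        show ?case
        proof (cases "norm (x $ N) = 1")
          case True
          \<comment> \<open>The exponent sum is positive here because the pole has positive order.\<close>
          then have "?w x = 0"
            using norm_abs_monomial_minus_le[OF elim, of N \<alpha>] Suc.prems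
            by (simp add: power_0_left split: if_splits)
          then show ?thesis by (simp add: F_def)
        next
          case False
          then show ?thesis using le1 by (intro tendsto_mult_left_zero LIMSEQ_power_zero) simp
        qed
      qed
    qed measurable
    then have "(\<lambda>K. sphere_mean (?R K)) \<longlonglongrightarrow> 0" by simp
    then have "(\<lambda>K. sphere_mean (?R (Suc K))) \<longlonglongrightarrow> 0" by (rule LIMSEQ_Suc)
    then show ?case
      by (simp add: split[symmetric] LIMSEQ_const_iff del: power_Suc)
  qed
  then show ?thesis by (simp only: F_def[abs_def])
qed

section \<open>The recurrence for the weighted means\<close>

text \<open>
  The integrand to which a product of matrix entries and conjugated entries reduces, off the null set
  \<open>x\<^sub>N = 1\<close>, when the exponents of every coordinate and of its conjugate agree. Negative exponents come from
  the denominators of the entries.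
\<close>
definition reflection_weight :: "'n \<Rightarrow> ('n \<Rightarrow> nat) \<Rightarrow> int \<Rightarrow> int \<Rightarrow> complex ^ 'n::finite \<Rightarrow> complex" where
  "reflection_weight N \<alpha> s t x =
    abs_monomial (UNIV - {N}) \<alpha> x * ((1 - x $ N) powi s * (1 - cnj (x $ N)) powi t)"

lemma borel_measurable_powi [measurable]: "(\<lambda>z :: complex. z powi s) \<in> borel_measurable borel"
  by (cases "s \<ge> 0") (simp_all add: power_int_def)

lemma borel_measurable_reflection_weight [measurable]:
  "reflection_weight N \<alpha> s t \<in> borel_measurable borel"
  unfolding reflection_weight_def by measurable

lemma norm_powi_times_cnj:
  assumes "v \<noteq> 0"
  shows "norm (v powi s * cnj v powi t) = norm v powi (s + t)"
  using assms by (simp add: norm_mult norm_power_int power_int_add)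

lemma integrable_reflection_weight:
  assumes "int (sum \<alpha> (UNIV - {N})) + s + t \<ge> 0"
  shows "integrable uniform_sphere (reflection_weight N \<alpha> s t)"
proof (rule integrable_uniform_sphere_bounded)
  let ?A = "sum \<alpha> (UNIV - {N})"
  fix x :: "complex ^ 'a" assume x: "norm x = 1" "x $ N \<noteq> 1"
  have "norm (reflection_weight N \<alpha> s t x)
      = norm (abs_monomial (UNIV - {N}) \<alpha> x) * norm (1 - x $ N) powi (s + t)"
    using x norm_powi_times_cnj[of "1 - x $ N" s t] by (simp add: reflection_weight_def norm_mult)
  also have "\<dots> \<le> (1 - (norm (x $ N))\<^sup>2) ^ ?A * norm (1 - x $ N) powi (s + t)"
    by (intro mult_right_mono norm_abs_monomial_minus_le x) auto
  also have "\<dots> \<le> 2 ^ ?A * 2 powi (int ?A + (s + t))"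
    using assms by (intro pole_bound x) auto
  finally show "norm (reflection_weight N \<alpha> s t x) \<le> 2 ^ ?A * 2 powi (int ?A + (s + t))" .
qed measurable

text \<open>
  Since the exponent of \<open>1 - x\<^sub>N\<close> is \<open>0\<close>, the factor in \<open>x\<^sub>N\<close> is antiholomorphic with value \<open>1\<close> at
  \<open>x\<^sub>N = 0\<close>, so it can be dropped, and an ordinary moment of the sphere remains.
\<close>
lemma sphere_mean_reflection_weight_base:
  fixes N :: "'n::finite"
  assumes "int (sum \<alpha> (UNIV - {N})) + t \<ge> 0"
  shows "sphere_mean (reflection_weight N \<alpha> 0 t) =
    (\<Prod>k\<in>UNIV - {N}. fact (\<alpha> k)) / pochhammer (of_nat CARD('n)) (sum \<alpha> (UNIV - {N}))"
proof -
  let ?w = "abs_monomial (UNIV - {N}) \<alpha>"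
  have "?w = abs_monomial UNIV (\<alpha>(N := 0))"
    unfolding abs_monomial_def fun_eq_iff by (subst prod.remove[of UNIV N]) (auto intro!: prod.cong)
  moreover have "(\<Prod>k\<in>UNIV. fact ((\<alpha>(N := 0)) k)) = (\<Prod>k\<in>UNIV - {N}. fact (\<alpha> k) :: complex)"
    by (subst prod.remove[of UNIV N]) (auto intro!: prod.cong)
  moreover have "sum (\<alpha>(N := 0)) UNIV = sum \<alpha> (UNIV - {N})"
    by (subst sum.remove[of UNIV N]) (auto intro!: sum.cong)
  ultimately have w: "sphere_mean ?w = (\<Prod>k\<in>UNIV - {N}. fact (\<alpha> k))
      / pochhammer (of_nat CARD('n)) (sum \<alpha> (UNIV - {N}))"
    using sphere_mean_abs_monomial[of "\<alpha>(N := 0)"] by simp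
  show ?thesis
  proof (cases "t \<ge> 0")
    case True
    have le0: "0 \<le> sum \<alpha> (UNIV - {N})" by simp
    have "reflection_weight N \<alpha> 0 t = (\<lambda>x. ?w x * (poly ([:1, -1:] ^ nat t) (cnj (x $ N)) / (1 - cnj (x $ N)) ^ 0))"
      using True by (simp add: reflection_weight_def[abs_def] power_int_def fun_eq_iff)
    then show ?thesis by (simp only: sphere_mean_antianalytic[OF le0]) (simp add: w)
  next
    case False
    have "reflection_weight N \<alpha> 0 t = (\<lambda>x. ?w x * (poly 1 (cnj (x $ N)) / (1 - cnj (x $ N)) ^ nat (-t)))"
      using False by (simp add: reflection_weight_def[abs_def] power_int_def fun_eq_iff divide_inverse power_inverse)
    moreover have "nat (- t) \<le> sum \<alpha> (UNIV - {N})" using assms by linarith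
    ultimately show ?thesis by (simp only: sphere_mean_antianalytic) (simp add: w)
  qed
qed

lemma sphere_mean_reflection_weight_swap:
  "sphere_mean (reflection_weight N \<alpha> s t) = cnj (sphere_mean (reflection_weight N \<alpha> t s))"
proof -
  have "reflection_weight N \<alpha> s t = (\<lambda>x. cnj (reflection_weight N \<alpha> t s x))"
    by (simp add: fun_eq_iff reflection_weight_def abs_monomial_def mult_ac)
  then show ?thesis by simp
qed

text \<open>
  With \<open>v = 1 - x\<^sub>N\<close> and \<open>w\<close> the conjugate of \<open>v\<close>, the equation of the sphere reads
  \<open>\<Sum>\<^bsub>k \<noteq> N\<^esub> \<bar>x\<^sub>k\<bar>\<^sup>2 = 1 - \<bar>x\<^sub>N\<bar>\<^sup>2 = v + w - v w\<close>. Multiplication of the weight by both sides gives the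
  recurrence.
\<close>
lemma sphere_mean_reflection_weight_rec:
  fixes N :: "'n::finite"
  assumes "int (sum \<alpha> (UNIV - {N})) + s + t + 1 \<ge> 0"
  shows "(\<Sum>k\<in>UNIV - {N}. sphere_mean (reflection_weight N (bump \<alpha> k) s t))
    = sphere_mean (reflection_weight N \<alpha> (s + 1) t) + sphere_mean (reflection_weight N \<alpha> s (t + 1))
      - sphere_mean (reflection_weight N \<alpha> (s + 1) (t + 1))"
proof -
  have int: "integrable uniform_sphere (reflection_weight N (bump \<alpha> k) s t)" if "k \<noteq> N" for k
  proof (rule integrable_reflection_weight)
    have "sum (bump \<alpha> k) (UNIV - {N}) = Suc (sum \<alpha> (UNIV - {N}))" by (rule sum_bump) (use that in auto)
    then show "0 \<le> int (sum (bump \<alpha> k) (UNIV - {N})) + s + t" using assms by linarith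
  qed
  have "(\<Sum>k\<in>UNIV - {N}. sphere_mean (reflection_weight N (bump \<alpha> k) s t))
      = sphere_mean (\<lambda>x. \<Sum>k\<in>UNIV - {N}. reflection_weight N (bump \<alpha> k) s t x)"
    by (rule Bochner_Integration.integral_sum[symmetric]) (use int in auto)
  also have "\<dots> = sphere_mean (\<lambda>x. reflection_weight N \<alpha> (s + 1) t x + reflection_weight N \<alpha> s (t + 1) x
      - reflection_weight N \<alpha> (s + 1) (t + 1) x)"
  proof (rule sphere_mean_cong)
    fix x :: "complex ^ 'n" assume x: "norm x = 1" "x $ N \<noteq> 1"
    define v where "v = 1 - x $ N"
    define W where "W = reflection_weight N \<alpha> s t x"
    have v: "v \<noteq> 0" using x by (simp add: v_def)
    have cv: "1 - cnj (x $ N) = cnj v" by (simp add: v_def)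
    have powi: "v powi (s + 1) = v powi s * v" "cnj v powi (t + 1) = cnj v powi t * cnj v"
      using v by (simp_all add: power_int_add_1)
    have "(\<Sum>k\<in>UNIV - {N}. x $ k * cnj (x $ k)) = of_real (\<Sum>k\<in>UNIV - {N}. (norm (x $ k))\<^sup>2)"
      by (simp add: complex_norm_square del: of_real_power)
    also have "\<dots> = 1 - x $ N * cnj (x $ N)"
      by (simp add: sum_norm_squares_minus x complex_norm_square del: of_real_power)
    also have "\<dots> = v + cnj v - v * cnj v" by (simp add: v_def algebra_simps)
    finally have sq: "(\<Sum>k\<in>UNIV - {N}. x $ k * cnj (x $ k)) = v + cnj v - v * cnj v" .
    have "(\<Sum>k\<in>UNIV - {N}. reflection_weight N (bump \<alpha> k) s t x) = (\<Sum>k\<in>UNIV - {N}. x $ k * cnj (x $ k) * W)"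
      by (intro sum.cong refl) (simp add: reflection_weight_def abs_monomial_bump W_def mult_ac del: fun_upd_apply)
    also have "\<dots> = (v + cnj v - v * cnj v) * W" by (simp only: sq flip: sum_distrib_right)
    also have "\<dots> = reflection_weight N \<alpha> (s + 1) t x + reflection_weight N \<alpha> s (t + 1) x
      - reflection_weight N \<alpha> (s + 1) (t + 1) x"
      by (simp only: reflection_weight_def W_def cv v_def[symmetric] powi) (simp add: algebra_simps)
    finally show "(\<Sum>k\<in>UNIV - {N}. reflection_weight N (bump \<alpha> k) s t x)
      = reflection_weight N \<alpha> (s + 1) t x + reflection_weight N \<alpha> s (t + 1) x
        - reflection_weight N \<alpha> (s + 1) (t + 1) x" .
  qed measurable
  also have "\<dots> = sphere_mean (reflection_weight N \<alpha> (s + 1) t) + sphere_mean (reflection_weight N \<alpha> s (t + 1))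
      - sphere_mean (reflection_weight N \<alpha> (s + 1) (t + 1))"
    using assms by (subst Bochner_Integration.integral_diff Bochner_Integration.integral_add;
      (intro Bochner_Integration.integrable_add integrable_reflection_weight)?; simp add: integrable_reflection_weight)+
  finally show ?thesis .
qed

lemma sphere_mean_reflection_weight_bump:
  fixes N :: "'n::finite"
  assumes "j \<noteq> N" "int (sum \<alpha> (UNIV - {N})) + s + t + 1 \<ge> 0"
  shows "of_nat (CARD('n) - 1 + sum \<alpha> (UNIV - {N})) * sphere_mean (reflection_weight N (bump \<alpha> j) s t)
    = of_nat (Suc (\<alpha> j)) * (\<Sum>k\<in>UNIV - {N}. sphere_mean (reflection_weight N (bump \<alpha> k) s t))"
proof -
  let ?S = "UNIV - {N}"
  define g where "g x = (1 - x $ N) powi s * (1 - cnj (x $ N)) powi t" for x :: "complex ^ 'n"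
  have [measurable]: "g \<in> borel_measurable borel" unfolding g_def by measurable
  have "integrable uniform_sphere (\<lambda>x. (\<Sum>i\<in>?S. (norm (x $ i))\<^sup>2) ^ Suc (sum \<alpha> ?S) * norm (g x))"
  proof (rule integrable_uniform_sphere_bounded)
    fix x :: "complex ^ 'n" assume x: "norm x = 1" "x $ N \<noteq> 1"
    have "norm (g x) = norm (1 - x $ N) powi (s + t)"
      using x norm_powi_times_cnj[of "1 - x $ N" s t] by (simp add: g_def)
    moreover have "1 - (norm (x $ N))\<^sup>2 \<ge> 0"
      using Finite_Cartesian_Product.norm_nth_le[of x N] x(1) by (simp add: power_le_one)
    ultimately show "norm ((\<Sum>i\<in>?S. (norm (x $ i))\<^sup>2) ^ Suc (sum \<alpha> ?S) * norm (g x))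
        \<le> 2 ^ Suc (sum \<alpha> ?S) * 2 powi (int (Suc (sum \<alpha> ?S)) + (s + t))"
      using pole_bound[OF x, of "Suc (sum \<alpha> ?S)" "s + t"] assms(2)
      by (simp add: sum_norm_squares_minus x norm_mult norm_power del: power_Suc)
  qed measurable
  then have "of_nat (card ?S + sum \<alpha> ?S) * sphere_mean (\<lambda>x. abs_monomial ?S (bump \<alpha> j) x * g x)
    = of_nat (Suc (\<alpha> j)) * (\<Sum>k\<in>?S. sphere_mean (\<lambda>x. abs_monomial ?S (bump \<alpha> k) x * g x))"
    using assms(1) by (intro abs_monomial_bump_sum) (auto simp: g_def)
  moreover have "card ?S = CARD('n) - 1" by (simp add: card_Diff_singleton)
  ultimately show ?thesis by (simp only: reflection_weight_def[abs_def] g_def)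
qed

section \<open>The closed form\<close>

definition reflection_moment :: "'n::finite \<Rightarrow> ('n \<Rightarrow> nat) \<Rightarrow> nat \<Rightarrow> nat \<Rightarrow> complex" where
  "reflection_moment N \<alpha> m l =
    (\<Prod>k\<in>UNIV - {N}. fact (\<alpha> k)) * pochhammer (of_nat CARD('n)) (m + l - sum \<alpha> (UNIV - {N}))
      / (pochhammer (of_nat CARD('n)) m * pochhammer (of_nat CARD('n)) l)"

lemma pochhammer_of_nat_nonzero: "c > 0 \<Longrightarrow> pochhammer (of_nat c :: complex) m \<noteq> 0"
proof -
  assume "c > 0"
  then have "(of_nat c :: complex) + of_nat k \<noteq> 0" for k by (simp flip: of_nat_add)
  then show ?thesis by (simp add: pochhammer_eq_0_iff eq_neg_iff_add_eq_0)
qed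

lemma reflection_moment_bump:
  fixes N :: "'n::finite"
  assumes "k \<noteq> N"
  shows "reflection_moment N (bump \<alpha> k) m l = of_nat (Suc (\<alpha> k)) *
    ((\<Prod>k\<in>UNIV - {N}. fact (\<alpha> k)) * pochhammer (of_nat CARD('n)) (m + l - Suc (sum \<alpha> (UNIV - {N})))
      / (pochhammer (of_nat CARD('n)) m * pochhammer (of_nat CARD('n)) l))"
  using assms by (simp add: reflection_moment_def prod_fact_bump sum_bump del: fun_upd_apply of_nat_Suc)

lemma reflection_moment_bump_sum:
  fixes N :: "'n::finite"
  shows "(\<Sum>k\<in>UNIV - {N}. reflection_moment N (bump \<alpha> k) m l) =
    of_nat (CARD('n) - 1 + sum \<alpha> (UNIV - {N})) *
    ((\<Prod>k\<in>UNIV - {N}. fact (\<alpha> k)) * pochhammer (of_nat CARD('n)) (m + l - Suc (sum \<alpha> (UNIV - {N})))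
      / (pochhammer (of_nat CARD('n)) m * pochhammer (of_nat CARD('n)) l))" (is "_ = _ * ?C")
proof -
  have "(\<Sum>k\<in>UNIV - {N}. reflection_moment N (bump \<alpha> k) m l) = (\<Sum>k\<in>UNIV - {N}. of_nat (Suc (\<alpha> k)) * ?C)"
    by (intro sum.cong refl reflection_moment_bump) auto
  also have "\<dots> = of_nat (\<Sum>k\<in>UNIV - {N}. Suc (\<alpha> k)) * ?C"
    by (simp only: of_nat_sum sum_distrib_right)
  also have "(\<Sum>k\<in>UNIV - {N}. Suc (\<alpha> k)) = CARD('n) - 1 + sum \<alpha> (UNIV - {N})"
    using sum.distrib[of "\<lambda>_. 1" \<alpha> "UNIV - {N}"] by (simp add: card_Diff_singleton)
  finally show ?thesis .
qed

text \<open>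
  After division by the common factors, with \<open>A = \<Sum>\<^bsub>k \<noteq> N\<^esub> \<alpha>\<^sub>k\<close> and \<open>c = m + l + 1 - A\<close>, the recurrence
  is \<open>n - 1 + A = (n + l) + (n + m) - (n + c)\<close>.
\<close>
lemma reflection_moment_rec:
  fixes N :: "'n::finite"
  assumes "sum \<alpha> (UNIV - {N}) \<le> m + l + 1"
  shows "(\<Sum>k\<in>UNIV - {N}. reflection_moment N (bump \<alpha> k) (Suc m) (Suc l))
    = reflection_moment N \<alpha> (Suc m) l + reflection_moment N \<alpha> m (Suc l) - reflection_moment N \<alpha> (Suc m) (Suc l)"
proof -
  define n :: complex where "n = of_nat CARD('n)"
  define A where "A = sum \<alpha> (UNIV - {N})"
  define c where "c = m + l + 1 - A"
  define F :: complex where "F = (\<Prod>k\<in>UNIV - {N}. fact (\<alpha> k))"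
  define u where "u = pochhammer n m"
  define w where "w = pochhammer n l"
  define q where "q = pochhammer n c"
  have nz: "u \<noteq> 0" "w \<noteq> 0" "n + of_nat m \<noteq> 0" "n + of_nat l \<noteq> 0"
    using pochhammer_of_nat_nonzero[of "CARD('n)"] by (simp_all add: u_def w_def n_def flip: of_nat_add)
  have "of_nat (CARD('n) - 1 + A) + n + (of_nat c :: complex) = (n + of_nat m) + (n + of_nat l)"
  proof -
    have "CARD('n) - 1 + A + CARD('n) + c = (CARD('n) + m) + (CARD('n) + l)"
      using assms zero_less_card_finite[where 'a = 'n] unfolding c_def A_def by linarith
    then show ?thesis unfolding n_def by (metis of_nat_add)
  qed
  then have num: "of_nat (CARD('n) - 1 + A) = (n + of_nat m) + (n + of_nat l) - (n + of_nat c)"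
    by (simp add: algebra_simps)
  have c: "Suc m + Suc l - Suc A = c" "Suc m + l - A = c" "m + Suc l - A = c" "Suc m + Suc l - A = Suc c"
    using assms by (auto simp: c_def A_def)
  then have "(\<Sum>k\<in>UNIV - {N}. reflection_moment N (bump \<alpha> k) (Suc m) (Suc l))
      = ((n + of_nat m) + (n + of_nat l) - (n + of_nat c)) * (F * q / ((u * (n + of_nat m)) * (w * (n + of_nat l))))"
    unfolding reflection_moment_bump_sum
    by (simp only: pochhammer_Suc num flip: n_def A_def F_def u_def w_def q_def)
  moreover have
    "reflection_moment N \<alpha> (Suc m) l = F * q / ((u * (n + of_nat m)) * w)"
    "reflection_moment N \<alpha> m (Suc l) = F * q / (u * (w * (n + of_nat l)))"
    "reflection_moment N \<alpha> (Suc m) (Suc l) = F * (q * (n + of_nat c)) / ((u * (n + of_nat m)) * (w * (n + of_nat l)))"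
    using c unfolding reflection_moment_def
    by (simp_all only: pochhammer_Suc flip: n_def A_def F_def u_def w_def q_def)
  moreover have "(a + b - d) * (F * q / ((u * a) * (w * b)))
      = F * q / ((u * a) * w) + F * q / (u * (w * b)) - F * (q * d) / ((u * a) * (w * b))"
    if "a \<noteq> 0" "b \<noteq> 0" for a b d
    using that nz by (simp add: field_simps)
  ultimately show ?thesis using nz by (simp only: not_False_eq_True)
qed

text \<open>
  The exponents of \<open>1 - x\<^sub>N\<close> and its conjugate that occur for products of \<open>m\<close> entries and \<open>l\<close> conjugated entries:
  they are \<open>\<alpha>\<^sub>N - l\<close> and \<open>\<alpha>\<^sub>N - m\<close>, where \<open>\<alpha>\<^sub>N = m + l - \<Sum>\<^bsub>k \<noteq> N\<^esub> \<alpha>\<^sub>k\<close>.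
\<close>
abbreviation weight_mean :: "'n::finite \<Rightarrow> ('n \<Rightarrow> nat) \<Rightarrow> nat \<Rightarrow> nat \<Rightarrow> complex" where
  "weight_mean N \<alpha> m l \<equiv> sphere_mean (reflection_weight N \<alpha>
     (int m - int (sum \<alpha> (UNIV - {N}))) (int l - int (sum \<alpha> (UNIV - {N}))))"

lemma weight_mean_rec:
  fixes N :: "'n::finite"
  assumes "sum \<alpha> (UNIV - {N}) \<le> m + l + 1"
  shows "(\<Sum>k\<in>UNIV - {N}. weight_mean N (bump \<alpha> k) (Suc m) (Suc l))
    = weight_mean N \<alpha> (Suc m) l + weight_mean N \<alpha> m (Suc l) - weight_mean N \<alpha> (Suc m) (Suc l)"
proof -
  let ?A = "sum \<alpha> (UNIV - {N})"
  have "(\<Sum>k\<in>UNIV - {N}. weight_mean N (bump \<alpha> k) (Suc m) (Suc l))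
      = (\<Sum>k\<in>UNIV - {N}. sphere_mean (reflection_weight N (bump \<alpha> k) (int m - int ?A) (int l - int ?A)))"
    by (intro sum.cong refl) (simp add: sum_bump del: fun_upd_apply of_nat_sum)
  also have "\<dots> = weight_mean N \<alpha> (Suc m) l + weight_mean N \<alpha> m (Suc l) - weight_mean N \<alpha> (Suc m) (Suc l)"
    using assms
    by (subst sphere_mean_reflection_weight_rec) (simp_all add: algebra_simps del: of_nat_sum)
  finally show ?thesis .
qed

lemma weight_mean_bump:
  fixes N :: "'n::finite"
  assumes "j \<noteq> N" "sum \<alpha> (UNIV - {N}) \<le> m + l + 1"
  shows "of_nat (CARD('n) - 1 + sum \<alpha> (UNIV - {N})) * weight_mean N (bump \<alpha> j) (Suc m) (Suc l)
    = of_nat (Suc (\<alpha> j)) * (\<Sum>k\<in>UNIV - {N}. weight_mean N (bump \<alpha> k) (Suc m) (Suc l))"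
proof -
  let ?A = "sum \<alpha> (UNIV - {N})"
  have shift: "weight_mean N (bump \<alpha> k) (Suc m) (Suc l)
      = sphere_mean (reflection_weight N (bump \<alpha> k) (int m - int ?A) (int l - int ?A))" if "k \<noteq> N" for k
    using that by (simp add: sum_bump del: fun_upd_apply of_nat_sum)
  have "(\<Sum>k\<in>UNIV - {N}. weight_mean N (bump \<alpha> k) (Suc m) (Suc l))
      = (\<Sum>k\<in>UNIV - {N}. sphere_mean (reflection_weight N (bump \<alpha> k) (int m - int ?A) (int l - int ?A)))"
    by (intro sum.cong refl shift) auto
  moreover have "int ?A + (int m - int ?A) + (int l - int ?A) + 1 \<ge> 0" using assms(2) by linarith
  ultimately show ?thesis
    using sphere_mean_reflection_weight_bump[OF assms(1)] by (simp only: shift[OF assms(1)])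
qed

text \<open>
  The induction is on \<open>\<bar>s\<bar> + \<bar>t\<bar>\<close>, where \<open>s = m - A\<close> and \<open>t = l - A\<close> are the two exponents and
  \<open>A = \<Sum>\<^bsub>k \<noteq> N\<^esub> \<alpha>\<^sub>k\<close>. Both sides satisfy the same recurrence, which relates the exponent pairs
  \<open>(s, t)\<close>, \<open>(s + 1, t)\<close>, \<open>(s, t + 1)\<close> and \<open>(s + 1, t + 1)\<close>, the first one with \<open>\<alpha>\<close> raised by one
  unit in some coordinate. The base case is \<open>s = 0\<close> or \<open>t = 0\<close>. Otherwise the recurrence is solved for the member of largest \<open>\<bar>s\<bar> + \<bar>t\<bar>\<close>, which depends on the
  signs of \<open>s\<close> and \<open>t\<close>. If both are negative, this member is the sum over the raised
  exponents, and proportionality of its summands separates them.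
\<close>
lemma weight_mean_eq_reflection_moment:
  fixes N :: "'n::finite"
  assumes "sum \<alpha> (UNIV - {N}) \<le> m + l"
  shows "weight_mean N \<alpha> m l = reflection_moment N \<alpha> m l"
  using assms
proof (induction "nat \<bar>int m - int (sum \<alpha> (UNIV - {N}))\<bar> + nat \<bar>int l - int (sum \<alpha> (UNIV - {N}))\<bar>"
    arbitrary: \<alpha> m l rule: less_induct)
  case less
  define A where "A = sum \<alpha> (UNIV - {N})"
  let ?\<mu> = "\<lambda>A m l. nat \<bar>int m - int A\<bar> + nat \<bar>int l - int A\<bar>"
  have IH: "weight_mean N \<beta> m' l' = reflection_moment N \<beta> m' l'"
    if "sum \<beta> (UNIV - {N}) = B" "?\<mu> B m' l' < ?\<mu> A m l" "B \<le> m' + l'" for \<beta> m' l' B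
    using less.hyps[of m' \<beta> l'] that unfolding A_def by (simp del: of_nat_sum)
  have IH_bump: "(\<Sum>k\<in>UNIV - {N}. weight_mean N (bump \<beta> k) m' l')
      = (\<Sum>k\<in>UNIV - {N}. reflection_moment N (bump \<beta> k) m' l')"
    if "sum \<beta> (UNIV - {N}) = B" "?\<mu> (Suc B) m' l' < ?\<mu> A m l" "Suc B \<le> m' + l'" for \<beta> m' l' B
    using that by (intro sum.cong refl IH[of _ "Suc B"]) (simp_all add: sum_bump del: fun_upd_apply of_nat_sum)
  have le: "A \<le> m + l" using less.prems by (simp add: A_def)
  note A = A_def[symmetric]
  have nz: "pochhammer (of_nat CARD('n) :: complex) k \<noteq> 0" for k
    by (rule pochhammer_of_nat_nonzero) simp
  consider "m = A" | "l = A" | "m > A" "l > A" | "m > A" "l < A" | "m < A" "l > A" | "m < A" "l < A"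
    by linarith
  then show ?case
  proof cases
    case 1
    then show ?thesis
      using nz by (simp add: A sphere_mean_reflection_weight_base reflection_moment_def del: of_nat_sum)
  next
    case 2
    then show ?thesis
      using nz by (subst sphere_mean_reflection_weight_swap)
        (simp add: A sphere_mean_reflection_weight_base reflection_moment_def pochhammer_of_nat del: of_nat_sum)
  next
    case 3
    then obtain m' l' where ml: "m = Suc m'" "l = Suc l'" by (metis less_imp_Suc_add)
    have "weight_mean N \<alpha> (Suc m') l' = reflection_moment N \<alpha> (Suc m') l'"
      "weight_mean N \<alpha> m' (Suc l') = reflection_moment N \<alpha> m' (Suc l')"
      using 3 by (intro IH[OF A]; simp add: ml)+
    moreover have "(\<Sum>k\<in>UNIV - {N}. weight_mean N (bump \<alpha> k) (Suc m') (Suc l'))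
      = (\<Sum>k\<in>UNIV - {N}. reflection_moment N (bump \<alpha> k) (Suc m') (Suc l'))"
      using 3 by (intro IH_bump[OF A]; simp add: ml)
    moreover have "sum \<alpha> (UNIV - {N}) \<le> m' + l' + 1" using 3 by (simp add: ml A)
    note weight_mean_rec[OF this] reflection_moment_rec[OF this]
    ultimately show ?thesis unfolding ml by (simp del: fun_upd_apply)
  next
    case 4
    then obtain m' where ml: "m = Suc m'" by (metis less_imp_Suc_add)
    have "weight_mean N \<alpha> m' (Suc l) = reflection_moment N \<alpha> m' (Suc l)"
      "weight_mean N \<alpha> (Suc m') (Suc l) = reflection_moment N \<alpha> (Suc m') (Suc l)"
      using 4 by (intro IH[OF A]; simp add: ml)+
    moreover have "(\<Sum>k\<in>UNIV - {N}. weight_mean N (bump \<alpha> k) (Suc m') (Suc l))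
      = (\<Sum>k\<in>UNIV - {N}. reflection_moment N (bump \<alpha> k) (Suc m') (Suc l))"
      using 4 by (intro IH_bump[OF A]; simp add: ml)
    moreover have "sum \<alpha> (UNIV - {N}) \<le> m' + l + 1" using le by (simp add: ml A)
    note weight_mean_rec[OF this] reflection_moment_rec[OF this]
    ultimately show ?thesis unfolding ml by (simp del: fun_upd_apply)
  next
    case 5
    then obtain l' where ml: "l = Suc l'" by (metis less_imp_Suc_add)
    have "weight_mean N \<alpha> (Suc m) l' = reflection_moment N \<alpha> (Suc m) l'"
      "weight_mean N \<alpha> (Suc m) (Suc l') = reflection_moment N \<alpha> (Suc m) (Suc l')"
      using 5 by (intro IH[OF A]; simp add: ml)+
    moreover have "(\<Sum>k\<in>UNIV - {N}. weight_mean N (bump \<alpha> k) (Suc m) (Suc l'))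
      = (\<Sum>k\<in>UNIV - {N}. reflection_moment N (bump \<alpha> k) (Suc m) (Suc l'))"
      using 5 by (intro IH_bump[OF A]; simp add: ml)
    moreover have "sum \<alpha> (UNIV - {N}) \<le> m + l' + 1" using le by (simp add: ml A)
    note weight_mean_rec[OF this] reflection_moment_rec[OF this]
    ultimately show ?thesis unfolding ml by (simp del: fun_upd_apply)
  next
    case 6
    then have "m > 0" "l > 0" "A > 0" using le by auto
    then obtain m' l' where ml: "m = Suc m'" "l = Suc l'" by (metis gr0_implies_Suc)
    obtain j \<beta> where j: "j \<in> UNIV - {N}" and \<alpha>: "\<alpha> = bump \<beta> j"
      using \<open>A > 0\<close> unfolding A_def by (rule ex_bump)
    have jN: "j \<noteq> N" using j by simp
    define B where "B = sum \<beta> (UNIV - {N})"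
    have AB: "A = Suc B" unfolding A_def \<alpha> B_def by (rule sum_bump[OF j])
    note B = B_def[symmetric]
    have B_le: "sum \<beta> (UNIV - {N}) \<le> m' + l' + 1" using le by (simp add: ml AB B)
    have "weight_mean N \<beta> (Suc m') l' = reflection_moment N \<beta> (Suc m') l'"
      "weight_mean N \<beta> m' (Suc l') = reflection_moment N \<beta> m' (Suc l')"
      "weight_mean N \<beta> (Suc m') (Suc l') = reflection_moment N \<beta> (Suc m') (Suc l')"
      using 6 le by (intro IH[OF B]; simp add: ml AB)+
    then have "(\<Sum>k\<in>UNIV - {N}. weight_mean N (bump \<beta> k) m l)
        = (\<Sum>k\<in>UNIV - {N}. reflection_moment N (bump \<beta> k) m l)"
      unfolding ml weight_mean_rec[OF B_le] reflection_moment_rec[OF B_le] by simp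
    then have "of_nat (CARD('n) - 1 + B) * weight_mean N \<alpha> m l
        = of_nat (Suc (\<beta> j)) * (\<Sum>k\<in>UNIV - {N}. reflection_moment N (bump \<beta> k) m l)"
      using weight_mean_bump[OF jN B_le] unfolding \<alpha> ml B by (simp only:)
    also have "\<dots> = of_nat (CARD('n) - 1 + B) * reflection_moment N \<alpha> m l"
      unfolding reflection_moment_bump_sum \<alpha> B reflection_moment_bump[OF jN] by (rule mult.left_commute)
    finally have eq: "of_nat (CARD('n) - 1 + B) * weight_mean N \<alpha> m l = of_nat (CARD('n) - 1 + B) * reflection_moment N \<alpha> m l" .
    have "CARD('n) > 1"
    proof -
      have "card {N, j} \<le> CARD('n)" by (rule card_mono) auto
      then show ?thesis using j by auto
    qed
    \<comment> \<open>For \<open>n = 1\<close> this factor could vanish, but then no coordinate \<open>j \<noteq> N\<close> exists.\<close>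
    then have "of_nat (CARD('n) - 1 + B) \<noteq> (0 :: complex)"
      unfolding of_nat_eq_0_iff by simp
    with eq show ?thesis by (simp only: mult_cancel_left simp_thms)
  qed
qed

section \<open>From matrix entries to weighted means\<close>

lemma prod_nth_count_list:
  fixes f :: "'a::finite \<Rightarrow> 'b::comm_monoid_mult"
  shows "(\<Prod>h<length xs. f (xs ! h)) = (\<Prod>k\<in>UNIV. f k ^ count_list xs k)"
proof (induction xs)
  case (Cons y ys)
  have "(\<Prod>h<length (y # ys). f ((y # ys) ! h)) = f y * (\<Prod>k\<in>UNIV. f k ^ count_list ys k)"
    by (simp add: prod.lessThan_Suc_shift Cons.IH del: prod.lessThan_Suc)
  also have "\<dots> = (\<Prod>k\<in>UNIV. (if k = y then f k else 1) * f k ^ count_list ys k)"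
    by (simp add: prod.distrib)
  also have "\<dots> = (\<Prod>k\<in>UNIV. f k ^ count_list (y # ys) k)"
    by (intro prod.cong) auto
  finally show ?case .
qed simp

text \<open>
  The product of matrix entries in terms of \<open>e\<^sub>N - X\<close>, whose coordinates are \<open>- x\<^sub>k\<close> for \<open>k \<noteq> N\<close> and
  \<open>1 - x\<^sub>N\<close>. The exponents \<open>a\<close> count the row indices of the entries together with the column indices of the
  conjugated entries; the exponents \<open>b\<close> count the others.
\<close>
definition entry_weight :: "'n::finite \<Rightarrow> ('n \<Rightarrow> nat) \<Rightarrow> ('n \<Rightarrow> nat) \<Rightarrow> nat \<Rightarrow> nat \<Rightarrow> complex ^ 'n \<Rightarrow> complex" where
  "entry_weight N a b m l x = (\<Prod>k\<in>UNIV - {N}. (- (x $ k)) ^ a k * cnj (- (x $ k)) ^ b k) *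
    ((1 - x $ N) ^ a N * cnj (1 - x $ N) ^ b N / (cnj (1 - x $ N) ^ m * (1 - x $ N) ^ l))"

text \<open>
  Each entry is \<open>v\<^sub>i\<close> times the conjugate of \<open>v\<^sub>j\<close>, divided by the conjugate of \<open>v\<^sub>N\<close>, where
  \<open>v = e\<^sub>N - x\<close>, so the product depends on the index sequences only through their multiplicities and lengths.
\<close>
lemma prod_refl_entry:
  fixes x :: "complex ^ 'n::finite"
  assumes x: "x $ N \<noteq> 1" and len: "length i = m" "length j = m" "length i' = l" "length j' = l"
  shows "(\<Prod>h<m. refl_entry N x (i ! h) (j ! h)) * cnj (\<Prod>h<l. refl_entry N x (i' ! h) (j' ! h))
    = entry_weight N (count_list (i @ j')) (count_list (j @ i')) m l x"
proof -
  define v where "v = axis N 1 - x"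
  have entries: "(\<Prod>h<length p. refl_entry N x (p ! h) (q ! h))
    = (\<Prod>k\<in>UNIV. v $ k ^ count_list p k) * (\<Prod>k\<in>UNIV. cnj (v $ k) ^ count_list q k) / cnj (v $ N) ^ length p"
    if "length q = length p" for p q
  proof -
    have "(\<Prod>h<length p. refl_entry N x (p ! h) (q ! h))
      = (\<Prod>h<length p. v $ (p ! h)) * (\<Prod>h<length q. cnj (v $ (q ! h))) / cnj (v $ N) ^ length p"
      using x that by (simp add: refl_entry_alt prod_dividef prod.distrib flip: v_def)
    then show ?thesis
      by (simp only: prod_nth_count_list[of "\<lambda>k. v $ k"] prod_nth_count_list[of "\<lambda>k. cnj (v $ k)"])
  qed
  have "(\<Prod>h<m. refl_entry N x (i ! h) (j ! h)) * cnj (\<Prod>h<l. refl_entry N x (i' ! h) (j' ! h))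
    = (\<Prod>k\<in>UNIV. v $ k ^ count_list (i @ j') k * cnj (v $ k) ^ count_list (j @ i') k)
      / (cnj (v $ N) ^ m * v $ N ^ l)"
    using entries[of j i] entries[of j' i'] len
    by (simp add: power_add prod.distrib mult_ac)
  also have "\<dots> = entry_weight N (count_list (i @ j')) (count_list (j @ i')) m l x"
    unfolding entry_weight_def
    by (subst prod.remove[of UNIV N]) (simp_all add: v_def axis_def)
  finally show ?thesis .
qed

lemma borel_measurable_entry_weight [measurable]: "entry_weight N a b m l \<in> borel_measurable borel"
  unfolding entry_weight_def by measurable

lemma sphere_mean_entry_weight_charged:
  fixes N :: "'n::finite"
  assumes "k \<noteq> N" "a k \<noteq> b k"
  shows "sphere_mean (entry_weight N a b m l) = 0"
proof (rule sphere_mean_charged_zero[OF _ assms(2), where k = k])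
  fix \<omega> :: complex and x :: "complex ^ 'n"
  let ?f = "\<lambda>x :: complex ^ 'n. \<lambda>k. (- (x $ k)) ^ a k * cnj (- (x $ k)) ^ b k"
  have "(\<Prod>i\<in>UNIV - {N}. ?f (rotate_coord k \<omega> x) i)
      = ?f (rotate_coord k \<omega> x) k * (\<Prod>i\<in>UNIV - {N} - {k}. ?f (rotate_coord k \<omega> x) i)"
    using assms(1) by (simp add: prod.remove)
  also have "(\<Prod>i\<in>UNIV - {N} - {k}. ?f (rotate_coord k \<omega> x) i) = (\<Prod>i\<in>UNIV - {N} - {k}. ?f x i)"
    by (intro prod.cong) (auto simp: rotate_coord_nth)
  also have "?f (rotate_coord k \<omega> x) k = \<omega> ^ a k * cnj \<omega> ^ b k * ?f x k"
  proof -
    have "?f (rotate_coord k \<omega> x) k = (\<omega> * - (x $ k)) ^ a k * cnj (\<omega> * - (x $ k)) ^ b k"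
      by (simp add: rotate_coord_nth)
    then show ?thesis by (simp only: power_mult_distrib complex_cnj_mult mult_ac)
  qed
  finally have "(\<Prod>i\<in>UNIV - {N}. ?f (rotate_coord k \<omega> x) i)
      = \<omega> ^ a k * cnj \<omega> ^ b k * (\<Prod>i\<in>UNIV - {N}. ?f x i)"
    using assms(1) by (simp add: prod.remove[of "UNIV - {N}" k] mult_ac)
  then show "entry_weight N a b m l (rotate_coord k \<omega> x) = \<omega> ^ a k * cnj \<omega> ^ b k * entry_weight N a b m l x"
    using assms(1) by (simp only: entry_weight_def) (simp add: rotate_coord_nth)
qed measurable

lemma sphere_mean_entry_weight:
  fixes N :: "'n::finite"
  assumes "sum a UNIV = m + l"
  shows "sphere_mean (entry_weight N a a m l) = (\<Prod>k\<in>UNIV - {N}. fact (a k)) *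
    pochhammer (of_nat CARD('n)) (a N) / (pochhammer (of_nat CARD('n)) m * pochhammer (of_nat CARD('n)) l)"
proof -
  define A where "A = sum a (UNIV - {N})"
  have A: "a N + A = m + l" using assms by (simp add: A_def sum.remove[of UNIV N])
  have "sphere_mean (entry_weight N a a m l) = weight_mean N a m l"
  proof (rule sphere_mean_cong)
    fix x :: "complex ^ 'n" assume "norm x = 1" "x $ N \<noteq> 1"
    define v where "v = 1 - x $ N"
    have v: "v \<noteq> 0" using \<open>x $ N \<noteq> 1\<close> by (simp add: v_def)
    have cv: "1 - cnj (x $ N) = cnj v" by (simp add: v_def)
    have st: "int m - int A = int (a N) - int l" "int l - int A = int (a N) - int m" using A by linarith+
    have "v powi (int (a N) - int l) = v ^ a N / v ^ l" "cnj v powi (int (a N) - int m) = cnj v ^ a N / cnj v ^ m"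
      using v by (simp_all add: power_int_diff)
    moreover have "(\<Prod>k\<in>UNIV - {N}. (- (x $ k)) ^ a k * cnj (- (x $ k)) ^ a k) = abs_monomial (UNIV - {N}) a x"
      unfolding abs_monomial_def by (intro prod.cong refl) (simp flip: power_mult_distrib)
    ultimately show "entry_weight N a a m l x
        = reflection_weight N a (int m - int (sum a (UNIV - {N}))) (int l - int (sum a (UNIV - {N}))) x"
      unfolding entry_weight_def reflection_weight_def A_def[symmetric] st cv v_def[symmetric] by simp
  qed measurable
  also have "\<dots> = reflection_moment N a m l"
    using A by (intro weight_mean_eq_reflection_moment) (simp add: A_def)
  also have "m + l - A = a N" using A by simp
  then have "reflection_moment N a m l = (\<Prod>k\<in>UNIV - {N}. fact (a k)) *
    pochhammer (of_nat CARD('n)) (a N) / (pochhammer (of_nat CARD('n)) m * pochhammer (of_nat CARD('n)) l)"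
    by (simp add: reflection_moment_def flip: A_def)
  finally show ?thesis .
qed

theorem theorem2p4:
  fixes N :: "'n::finite"
    and M :: "'w measure"
    and X :: "'w \<Rightarrow> complex ^ 'n"
    and R :: "'w \<Rightarrow> complex ^ 'n ^ 'n"
    and m l :: nat
    and i j i' j' :: "'n list"
  assumes "prob_space M"
    and "X \<in> borel_measurable M"
    and "distr M borel X = uniform_sphere"
    and "R \<in> borel_measurable M"
    and "AE \<omega> in M. complex_reflection (R \<omega>) \<and> R \<omega> *v axis N 1 = X \<omega>"
    and "length i = m" "length j = m" "length i' = l" "length j' = l"
  defines "P \<equiv> \<lambda>\<omega>. mat 1 - R \<omega>"
    and "\<alpha> \<equiv> count_list (i @ j')"
    and "n \<equiv> CARD('n)"
  shows "prob_space.expectation M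
      (\<lambda>\<omega>. (\<Prod>h<m. P \<omega> $ (i ! h) $ (j ! h)) * cnj (\<Prod>h<l. P \<omega> $ (i' ! h) $ (j' ! h))) =
    (if mset (i @ j') = mset (j @ i')
     then (\<Prod>k\<in>UNIV - {N}. fact (\<alpha> k)) * pochhammer (of_nat n) (\<alpha> N)
            / (pochhammer (of_nat n) m * pochhammer (of_nat n) l)
     else 0)"
proof -
  define \<beta> where "\<beta> = count_list (j @ i')"
  let ?W = "entry_weight N \<alpha> \<beta> m l"
  let ?f = "\<lambda>\<omega>. (\<Prod>h<m. P \<omega> $ (i ! h) $ (j ! h)) * cnj (\<Prod>h<l. P \<omega> $ (i' ! h) $ (j' ! h))"
  have AE_norm: "AE \<omega> in M. norm (X \<omega>) = 1"
  proof (rule AE_distrD[OF assms(2)])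
    show "AE x in distr M borel X. norm x = 1" unfolding assms(3) by (rule AE_uniform_sphere_norm)
  qed
  have AE_neq: "AE \<omega> in M. X \<omega> $ N \<noteq> 1"
    using AE_uniform_sphere_nth_neq_1[of N] unfolding assms(3)[symmetric] by (rule AE_distrD[OF assms(2)])
  have "integral\<^sup>L M ?f = integral\<^sup>L M (\<lambda>\<omega>. ?W (X \<omega>))"
  proof (rule integral_cong_AE)
    have "AE \<omega> in M. complex_reflection (R \<omega>)" using assms(5) by eventually_elim simp
    then show "?f \<in> borel_measurable M"
      unfolding P_def by (intro borel_measurable_integrable integrable_entry_moment assms)
    show "(\<lambda>\<omega>. ?W (X \<omega>)) \<in> borel_measurable M"
      using assms(2) borel_measurable_entry_weight by (rule measurable_compose)
    show "AE \<omega> in M. ?f \<omega> = ?W (X \<omega>)"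
      using assms(5) AE_norm AE_neq
    proof eventually_elim
      case (elim \<omega>)
      then have "P \<omega> $ a $ b = refl_entry N (X \<omega>) a b" for a b
        unfolding P_def by (intro complex_reflection_entries) auto
      then show ?case
        using prod_refl_entry[OF elim(3) assms(6-9)] by (simp add: \<alpha>_def \<beta>_def)
    qed
  qed
  also have "\<dots> = sphere_mean ?W"
    using integral_distr[OF assms(2) borel_measurable_entry_weight] by (simp add: assms(3))
  also have "\<dots> = (if mset (i @ j') = mset (j @ i')
     then (\<Prod>k\<in>UNIV - {N}. fact (\<alpha> k)) * pochhammer (of_nat n) (\<alpha> N)
            / (pochhammer (of_nat n) m * pochhammer (of_nat n) l)
     else 0)"
  proof -
    have mset: "mset (i @ j') = mset (j @ i') \<longleftrightarrow> \<alpha> = \<beta>"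
      by (simp only: multiset_eq_iff count_mset \<alpha>_def \<beta>_def fun_eq_iff)
    have total: "sum \<alpha> UNIV = m + l" "sum \<beta> UNIV = m + l"
      unfolding \<alpha>_def \<beta>_def by (simp_all only: sum_count_set[OF subset_UNIV finite] length_append assms(6-9) add.commute)
    show ?thesis
    proof (cases "\<alpha> = \<beta>")
      case True
      then show ?thesis unfolding mset using total by (simp add: sphere_mean_entry_weight n_def)
    next
      case False
      \<comment> \<open>Both multiplicity functions have total \<open>m + l\<close>, so they cannot differ at \<open>N\<close> alone.\<close>
      have "\<exists>k. k \<noteq> N \<and> \<alpha> k \<noteq> \<beta> k"
      proof (rule ccontr)
        assume eq: "\<not> ?thesis"
        then have "sum \<alpha> (UNIV - {N}) = sum \<beta> (UNIV - {N})" by (intro sum.cong) auto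
        then have "\<alpha> N = \<beta> N" using total by (simp add: sum.remove[of UNIV N])
        with eq False show False by (metis ext)
      qed
      then show ?thesis unfolding mset using False sphere_mean_entry_weight_charged by fastforce
    qed
  qed
  finally show ?thesis .
qed

end
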